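(* Let $\Omega\subset\mathbb{R}^n$ ($n\ge 2$) be a convex domain, let $F=F(x,y)$ be the Funk metric on $\Omega$, and let $\mathbf{G}$ (with coefficients $G^i$) be the spray of $F$. For a constant $c$, define a spray $\bar{\mathbf{G}}$ on $\Omega$ by $$\bar G^i(x,y):=G^i(x,y)+c\,F(x,-y)\,y^i .$$ Then: (i) $\bar{\mathbf{G}}$ is of isotropic curvature. Further, $\bar{\mathbf{G}}$ is of constant curvature if and only if $c=0$ or $c=-1/2$. (ii) $\bar{\mathbf{G}}$ is (locally) metrizable if and only if $c=0$ or $c=-1/2$. In this case, $\bar{\mathbf{G}}$ is induced by $F$ if $c=0$; and if $c=-1/2$, $\bar{\mathbf{G}}$ is induced by the Klein metric $\bar F(x,y):=\frac12\big[F(x,y)+F(x,-y)\big]$.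
   Context: Conical regions and sprays. A conical region $\mathcal{C}=\mathcal{C}(M)$ of $TM\setminus\{0\}$ for a manifold $M$ is an open set such that each $\mathcal{C}_x=\mathcal{C}\cap (T_xM\setminus\{0\})$ is closed under $y\mapsto \lambda y$, $\lambda>0$. A spray on $M$ is a smooth vector field on a conical region $\mathcal C$, expressed in local coordinates $(x^i,y^i)$ as $\mathbf{G}=y^i\frac{\partial}{\partial x^i}-2G^i\frac{\partial}{\partial y^i}$ with $G^i=G^i(x,y)$ positively homogeneous of degree two in $y$. Put $\partial_k=\partial/\partial x^k$, $\dot\partial_k=\partial/\partial y^k$. Riemann curvature: $R^i_{\ k}=2\partial_kG^i-y^j\partial_j\dot\partial_kG^i+2G^j\dot\partial_j\dot\partial_kG^i-(\dot\partial_jG^i)(\dot\partial_kG^j)$. A spray is of scalar curvature if $R^i_{\ k}=R\,\delta^i_k-\tau_k y^i$ for some homogeneous functions $R=R(x,y)$, $\tau_k=\tau_k(x,y)$. It is of isotropic curvature if moreover $\dot\partial_i R=2\tau_i$. It is of constant curvature if it is of scalar curvature and $\tau_{i;k}=0$, where ";" is the horizontal covariant derivative of the Berwald connection: $\tau_{i;k}=\delta_k\tau_i-\tau_rG^r_{ik}$, with $G^r_i=\dot\partial_iG^r$, $G^r_{ij}=\dot\partial_j\dot\partial_iG^r$, $\delta_i=\partial_i-G^r_i\dot\partial_r$. (Equivalently, either $R=0$ and $\tau_k=0$, or $\delta_iR=0$.) Finsler metrics. A Finsler metric on $M$ is a $C^\infty$ function $L\neq0$ on a conical region, positively homogeneous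 of degree two in $y$, with $g_{ij}=(\frac12L)_{y^iy^j}$ nondegenerate (not necessarily positive definite). If $L=F^2>0$, $F$ is also called a Finsler metric. $L$ induces the spray $G^i=\frac14g^{il}\{L_{x^ky^l}y^k-L_{x^l}\}$. A spray is metrizable on $M$ if it is induced by some Finsler metric defined on a conical region $\mathcal{C}(M)$; it is locally metrizable if each point of $M$ has a neighbourhood on which it is metrizable. Funk metric. The Funk metric on $\Omega$ is the function $F(x,y)>0$ ($x\in\Omega$, $y\ne0$) determined by $x+\frac{y}{F(x,y)}\in\partial\Omega$; the domain $\Omega$ is understood to be such that $F$ is a Finsler metric (standardly: bounded, strongly convex, with smooth boundary). *)

theory Defs
  imports "HOL-Analysis.Analysis"
begin

text \<open>
  The manifolds are open subsets \<open>M\<close> of $R^n$ with their standard coordinates, so that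
  $TM \setminus 0$ is \<open>M \<times> (- {0})\<close>. Functions on (parts of) it are curried, \<open>f x y\<close> with
  \<open>x\<close> the base point and \<open>y\<close> the fibre coordinate. Only the values on the region at hand matter;
  all regions are open, so derivatives at points of a region do not depend on the values outside.
\<close>

type_synonym 'n phase_fun = "real ^ 'n \<Rightarrow> real ^ 'n \<Rightarrow> real"
type_synonym 'n phase_field = "real ^ 'n \<Rightarrow> real ^ 'n \<Rightarrow> real ^ 'n"


subsection \<open>Smoothness and partial derivatives\<close>

text \<open>To be used for open \<open>U\<close> only.\<close>

primrec Ck_on :: "nat \<Rightarrow> ('a::euclidean_space \<Rightarrow> real) \<Rightarrow> 'a set \<Rightarrow> bool" where
  "Ck_on 0 f U \<longleftrightarrow> continuous_on U f"
| "Ck_on (Suc k) f U \<longleftrightarrow>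
     (\<forall>x\<in>U. f differentiable (at x)) \<and> (\<forall>v. Ck_on k (\<lambda>x. frechet_derivative f (at x) v) U)"

definition smooth_on :: "('a::euclidean_space \<Rightarrow> real) \<Rightarrow> 'a set \<Rightarrow> bool" where
  "smooth_on f U \<longleftrightarrow> (\<forall>k. Ck_on k f U)"

definition smooth_phase :: "((real ^ 'n) \<times> (real ^ 'n)) set \<Rightarrow> 'n::finite phase_fun \<Rightarrow> bool" where
  "smooth_phase C f \<longleftrightarrow> smooth_on (\<lambda>(x, y). f x y) C"

text \<open>\<open>dx k\<close> is $\partial/\partial x^k$ and \<open>dy k\<close> is $\partial/\partial y^k$.\<close>

definition dx :: "'n \<Rightarrow> 'n::finite phase_fun \<Rightarrow> 'n phase_fun" where
  "dx k f x y = deriv (\<lambda>t. f (x + t *\<^sub>R axis k 1) y) 0"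

definition dy :: "'n \<Rightarrow> 'n::finite phase_fun \<Rightarrow> 'n phase_fun" where
  "dy k f x y = deriv (\<lambda>t. f x (y + t *\<^sub>R axis k 1)) 0"

definition coord :: "'n::finite phase_field \<Rightarrow> 'n \<Rightarrow> 'n phase_fun" where
  "coord G i = (\<lambda>x y. G x y $ i)"


subsection \<open>Conical regions and sprays\<close>

definition slit_tangent :: "(real ^ 'n::finite) set \<Rightarrow> ((real ^ 'n) \<times> (real ^ 'n)) set" where
  "slit_tangent M = M \<times> (- {0})"

text \<open>
  Every fibre of a conical region over \<open>M\<close> has to be nonempty: otherwise the empty set would be
  a conical region and every spray would be metrizable.
\<close>

definition conical_region ::
    "(real ^ 'n::finite) set \<Rightarrow> ((real ^ 'n) \<times> (real ^ 'n)) set \<Rightarrow> bool" where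
  "conical_region M C \<longleftrightarrow> open C \<and> C \<subseteq> slit_tangent M \<and>
     (\<forall>x\<in>M. \<exists>y. (x, y) \<in> C) \<and>
     (\<forall>x y. \<forall>s>0. (x, y) \<in> C \<longrightarrow> (x, s *\<^sub>R y) \<in> C)"

definition pos_homogeneous ::
    "nat \<Rightarrow> ((real ^ 'n) \<times> (real ^ 'n)) set \<Rightarrow> 'n::finite phase_fun \<Rightarrow> bool" where
  "pos_homogeneous d C f \<longleftrightarrow> (\<forall>(x, y)\<in>C. \<forall>s>0. f x (s *\<^sub>R y) = s ^ d * f x y)"

text \<open>
  A spray $y^i \partial/\partial x^i - 2 G^i \partial/\partial y^i$ on the conical region \<open>C\<close>
  is represented by its coefficients, \<open>G x y $ i\<close> being $G^i(x,y)$.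
\<close>

definition spray ::
    "(real ^ 'n) set \<Rightarrow> ((real ^ 'n) \<times> (real ^ 'n)) set \<Rightarrow> 'n::finite phase_field \<Rightarrow> bool" where
  "spray M C G \<longleftrightarrow> conical_region M C \<and>
     (\<forall>i. smooth_phase C (coord G i) \<and> pos_homogeneous 2 C (coord G i))"


subsection \<open>Curvature\<close>

text \<open>\<open>riemann_curv G i k\<close> is $R^i{}_k$.\<close>

definition riemann_curv :: "'n::finite phase_field \<Rightarrow> 'n \<Rightarrow> 'n \<Rightarrow> 'n phase_fun" where
  "riemann_curv G i k x y =
     2 * dx k (coord G i) x y
     - (\<Sum>j\<in>UNIV. y $ j * dx j (dy k (coord G i)) x y)
     + 2 * (\<Sum>j\<in>UNIV. G x y $ j * dy j (dy k (coord G i)) x y)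
     - (\<Sum>j\<in>UNIV. dy j (coord G i) x y * dy k (coord G j) x y)"

text \<open>
  The degrees of homogeneity of $R$ and $\tau_k$ are those forced by the fact that $R^i{}_k$ is
  homogeneous of degree two.
\<close>

definition scalar_curvature_with ::
    "((real ^ 'n) \<times> (real ^ 'n)) set \<Rightarrow> 'n::finite phase_field \<Rightarrow> 'n phase_fun \<Rightarrow> 'n phase_field \<Rightarrow> bool"
  where
  "scalar_curvature_with C G R \<tau> \<longleftrightarrow>
     smooth_phase C R \<and> pos_homogeneous 2 C R \<and>
     (\<forall>k. smooth_phase C (coord \<tau> k) \<and> pos_homogeneous 1 C (coord \<tau> k)) \<and>
     (\<forall>(x, y)\<in>C. \<forall>i k.
        riemann_curv G i k x y = R x y * of_bool (i = k) - \<tau> x y $ k * y $ i)"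

definition isotropic_curvature ::
    "((real ^ 'n) \<times> (real ^ 'n)) set \<Rightarrow> 'n::finite phase_field \<Rightarrow> bool" where
  "isotropic_curvature C G \<longleftrightarrow>
     (\<exists>R \<tau>. scalar_curvature_with C G R \<tau> \<and>
        (\<forall>(x, y)\<in>C. \<forall>i. dy i R x y = 2 * \<tau> x y $ i))"

text \<open>
  $\delta_k f = \partial_k f - G^r_k \dot\partial_r f$ and
  $\tau_{i;k} = \delta_k \tau_i - \tau_r G^r_{ik}$ for the Berwald connection
  $G^r_i = \dot\partial_i G^r$, $G^r_{ik} = \dot\partial_k \dot\partial_i G^r$.
\<close>

definition hor_deriv :: "'n::finite phase_field \<Rightarrow> 'n \<Rightarrow> 'n phase_fun \<Rightarrow> 'n phase_fun" where
  "hor_deriv G k f x y = dx k f x y - (\<Sum>r\<in>UNIV. dy k (coord G r) x y * dy r f x y)"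

definition berwald_deriv ::
    "'n::finite phase_field \<Rightarrow> 'n phase_field \<Rightarrow> 'n \<Rightarrow> 'n \<Rightarrow> 'n phase_fun" where
  "berwald_deriv G \<tau> i k x y =
     hor_deriv G k (coord \<tau> i) x y - (\<Sum>r\<in>UNIV. \<tau> x y $ r * dy k (dy i (coord G r)) x y)"

definition constant_curvature ::
    "((real ^ 'n) \<times> (real ^ 'n)) set \<Rightarrow> 'n::finite phase_field \<Rightarrow> bool" where
  "constant_curvature C G \<longleftrightarrow>
     (\<exists>R \<tau>. scalar_curvature_with C G R \<tau> \<and>
        (\<forall>(x, y)\<in>C. \<forall>i k. berwald_deriv G \<tau> i k x y = 0))"


subsection \<open>Finsler metrics and metrizability\<close>

definition fund_tensor :: "'n::finite phase_fun \<Rightarrow> real ^ 'n \<Rightarrow> real ^ 'n \<Rightarrow> real ^ 'n ^ 'n" where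
  "fund_tensor L x y = (\<chi> i j. dy j (dy i (\<lambda>x y. 1/2 * L x y)) x y)"

definition finsler_metric ::
    "(real ^ 'n) set \<Rightarrow> ((real ^ 'n) \<times> (real ^ 'n)) set \<Rightarrow> 'n::finite phase_fun \<Rightarrow> bool" where
  "finsler_metric M C L \<longleftrightarrow> conical_region M C \<and> smooth_phase C L \<and> pos_homogeneous 2 C L \<and>
     (\<forall>(x, y)\<in>C. L x y \<noteq> 0 \<and> invertible (fund_tensor L x y))"

text \<open>The case $L = F^2 > 0$, where $F$ itself is called a Finsler metric.\<close>

definition pos_finsler_metric ::
    "(real ^ 'n) set \<Rightarrow> ((real ^ 'n) \<times> (real ^ 'n)) set \<Rightarrow> 'n::finite phase_fun \<Rightarrow> bool" where
  "pos_finsler_metric M C F \<longleftrightarrow>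
     (\<forall>(x, y)\<in>C. F x y > 0) \<and> finsler_metric M C (\<lambda>x y. (F x y)\<^sup>2)"

text \<open>$G^i = \frac14 g^{il} (L_{x^k y^l} y^k - L_{x^l})$\<close>

definition finsler_spray :: "'n::finite phase_fun \<Rightarrow> 'n phase_field" where
  "finsler_spray L x y = (\<chi> i. 1/4 * (\<Sum>l\<in>UNIV. matrix_inv (fund_tensor L x y) $ i $ l *
     ((\<Sum>k\<in>UNIV. dy l (dx k L) x y * y $ k) - dx l L x y)))"

definition induced_by :: "((real ^ 'n) \<times> (real ^ 'n)) set \<Rightarrow>
    'n::finite phase_field \<Rightarrow> 'n phase_fun \<Rightarrow> bool" where
  "induced_by C G L \<longleftrightarrow> (\<forall>(x, y)\<in>C. G x y = finsler_spray L x y)"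

text \<open>
  In the next two definitions \<open>D\<close> is the conical region on which the spray \<open>G\<close> is defined; the
  metric may live on a smaller conical region \<open>C\<close>.
\<close>

definition metrizable_over ::
    "(real ^ 'n) set \<Rightarrow> ((real ^ 'n) \<times> (real ^ 'n)) set \<Rightarrow> 'n::finite phase_field \<Rightarrow> bool" where
  "metrizable_over M D G \<longleftrightarrow> (\<exists>C L. C \<subseteq> D \<and> finsler_metric M C L \<and> induced_by C G L)"

definition locally_metrizable_over ::
    "(real ^ 'n) set \<Rightarrow> ((real ^ 'n) \<times> (real ^ 'n)) set \<Rightarrow> 'n::finite phase_field \<Rightarrow> bool" where
  "locally_metrizable_over M D G \<longleftrightarrow>
     (\<forall>p\<in>M. \<exists>U. open U \<and> p \<in> U \<and> U \<subseteq> M \<and> metrizable_over U D G)"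


subsection \<open>The Funk metric, the Klein metric and the deformed spray\<close>

text \<open>
  If \<open>\<Omega>\<close> is open and convex, this determines \<open>F\<close> on the slit tangent bundle, since a ray starting
  in \<open>\<Omega>\<close> meets the boundary at most once. That it does so for every direction \<open>y\<close> means that
  \<open>\<Omega>\<close> is bounded.
\<close>

definition funk_metric :: "(real ^ 'n::finite) set \<Rightarrow> 'n phase_fun \<Rightarrow> bool" where
  "funk_metric \<Omega> F \<longleftrightarrow>
     (\<forall>x\<in>\<Omega>. \<forall>y. y \<noteq> 0 \<longrightarrow> F x y > 0 \<and> x + (1 / F x y) *\<^sub>R y \<in> frontier \<Omega>)"

definition klein_metric :: "'n::finite phase_fun \<Rightarrow> 'n phase_fun" where
  "klein_metric F x y = 1/2 * (F x y + F x (- y))"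

definition deformed_spray :: "'n::finite phase_fun \<Rightarrow> real \<Rightarrow> 'n phase_field" where
  "deformed_spray F c x y = finsler_spray (\<lambda>x y. (F x y)\<^sup>2) x y + (c * F x (- y)) *\<^sub>R y"

end

theory Submission
  imports Defs
begin

text \<open>
  Let $F'(x,y) = F(x,-y)$, written \<open>Frev\<close> below. Moving $x$ by $tw$ and $y$ by $-tF(x,y)w$ keeps the
  boundary point $x + y/F(x,y)$ fixed, so $F$ is constant along such lines. This gives Okada's
  identity $F_{x^k} = F F_{y^k}$ (\<open>dx_funk\<close>) and, reversing $y$, $F'_{x^k} = - F' F'_{y^k}$. They turn
  all derivatives that occur into polynomials in $F$, $F'$ and their vertical derivatives.

  A function $L$ of degree two with nondegenerate fundamental tensor induces the spray $P y^i$ if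
  and only if $L_{x^k} = 2 P_{y^k} L + P L_{y^k}$ (\<open>finsler_spray_projective\<close>). By Okada's identity
  $F^2$ solves this equation for $P = F/2$. So the deformed spray is $P y^i$ with $P = F/2 + c F'$,
  and the square of the Klein metric solves the equation for $c = -1/2$. That the Klein metric is
  nondegenerate comes from convexity: $F$ is subadditive in $y$, so its vertical Hessian is positive
  semidefinite, and its kernel is spanned by $y$.

  The factor $P$ satisfies Hamel's equation $y^j P_{x^j y^k} = P_{x^k}$. Therefore the curvature is
  $R \delta^i_k - \tau_k y^i$ with $R = P^2 - y^j P_{x^j}$ and $2 \tau_k = R_{y^k}$, which is isotropic.
  A computation gives $R_{;k} = - c (2c+1) Q_{y^k}$ with $Q = F F'^2 + (2/3)(c+1) F'^3$, hence
  $2 \tau_{i;k} = - c (2c+1) Q_{y^i y^k}$ (\<open>berwald_deriv_tau\<close>). This vanishes for $c = 0$ and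
  $c = -1/2$; for other $c$ it would force $Q = 0$, but $Q$ does not vanish on any open set
  (\<open>Q_not_zero\<close>).

  Suppose that $L$ induces $P y^i$ over some open set and $c (2c+1) \ne 0$. The integrability
  condition of the equation for $L$ is $R L_{y^k} = R_{y^k} L$, so $\lambda = R/L$ is
  locally constant in $y$, and then so is $\lambda_{x^k} = - c (2c+1) Q_{y^k} / L$. It follows that
  the vertical gradients of $Q$, $L$ and $R$ are proportional where $Q \ne 0$. Those of $Q$ and $R$ are combinations of the
  gradients of $F$ and $F'$ with a nonzero determinant, so the gradient of $F$ is proportional to
  them as well, and one more differentiation gives $F_{y^k y^l} = 0$. Then the fundamental tensor
  of $F^2$ has rank one, contrary to $n \ge 2$ (\<open>not_metrizable\<close>).
\<close>

section \<open>Smooth functions on open sets\<close>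

abbreviation ddir :: "'a::euclidean_space \<Rightarrow> ('a \<Rightarrow> real) \<Rightarrow> 'a \<Rightarrow> real" where
  "ddir v f x \<equiv> frechet_derivative f (at x) v"

lemma ddir_eqI: "(f has_derivative f') (at x) \<Longrightarrow> ddir v f x = f' v"
  using frechet_derivative_at by metis

lemma has_derivative_ddir:
  "f differentiable (at x) \<Longrightarrow> (f has_derivative (\<lambda>v. ddir v f x)) (at x)"
  using frechet_derivative_works by blast

lemma ddir_cong:
  assumes "open U" "x \<in> U" "\<And>z. z \<in> U \<Longrightarrow> f z = g z"
  shows "ddir v f x = ddir v g x"
proof -
  have "(f has_derivative f') (at x) \<longleftrightarrow> (g has_derivative f') (at x)" for f'
    using assms by (metis has_derivative_transform_within_open)
  then show ?thesis by (simp add: frechet_derivative_def)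
qed

lemma differentiable_cong_open:
  assumes "open U" "x \<in> U" "\<And>z. z \<in> U \<Longrightarrow> f z = g z"
  shows "f differentiable (at x) \<longleftrightarrow> g differentiable (at x)"
  unfolding differentiable_def
  using has_derivative_transform_within_open[OF _ assms(1,2), of f _ UNIV g]
    has_derivative_transform_within_open[OF _ assms(1,2), of g _ UNIV f] assms(3) by metis

lemma Ck_on_cong:
  assumes "open U" "\<And>z. z \<in> U \<Longrightarrow> f z = g z"
  shows "Ck_on k f U \<longleftrightarrow> Ck_on k g U"
  using assms(2)
proof (induction k arbitrary: f g)
  case 0
  then show ?case by (simp cong: continuous_on_cong)
next
  case (Suc k)
  have "Ck_on k (\<lambda>x. ddir v f x) U \<longleftrightarrow> Ck_on k (\<lambda>x. ddir v g x) U" for v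
    using Suc.prems assms(1) by (intro Suc.IH ddir_cong)
  moreover have "f differentiable (at x) \<longleftrightarrow> g differentiable (at x)" if "x \<in> U" for x
    using differentiable_cong_open[OF assms(1) that] Suc.prems by blast
  ultimately show ?case by auto
qed

lemma Ck_on_Suc_imp: "Ck_on (Suc k) f U \<Longrightarrow> Ck_on k f U"
proof (induction k arbitrary: f)
  case 0
  then show ?case
    by (auto intro!: continuous_at_imp_continuous_on differentiable_imp_continuous_within)
next
  case (Suc k)
  then show ?case using Suc.IH by simp
qed

lemma Ck_on_subset: "Ck_on k f U \<Longrightarrow> V \<subseteq> U \<Longrightarrow> Ck_on k f V"
  by (induction k arbitrary: f) (auto intro: continuous_on_subset)

lemma Ck_on_const: "Ck_on k (\<lambda>x. c) U"
proof (induction k arbitrary: c)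
  case (Suc k)
  show ?case using Suc[of 0] by simp
qed simp

lemma Ck_on_bounded_linear: "bounded_linear f \<Longrightarrow> Ck_on k f U"
proof (cases k)
  case 0
  assume "bounded_linear f"
  with 0 show ?thesis by (simp add: linear_continuous_on)
next
  case (Suc m)
  assume f: "bounded_linear f"
  have "ddir v f x = f v" for v x
    by (rule ddir_eqI) (rule bounded_linear_imp_has_derivative[OF f])
  with Suc f show ?thesis
    by (simp add: Ck_on_const bounded_linear_imp_differentiable)
qed

text \<open>
  The recursion behind all closure properties: it is enough to know a derivative explicitly and
  to know that its components are one degree less smooth. Differentiability then need not be
  argued separately.
\<close>

lemma Ck_on_SucI:
  assumes "open U" "\<And>x. x \<in> U \<Longrightarrow> (f has_derivative (\<lambda>v. f' v x)) (at x)"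
    "\<And>v. Ck_on k (f' v) U"
  shows "Ck_on (Suc k) f U"
proof -
  have "ddir v f x = f' v x" if "x \<in> U" for v x
    using assms(2)[OF that] by (rule ddir_eqI)
  then have "Ck_on k (\<lambda>x. ddir v f x) U" for v
    using assms(3)[of v] Ck_on_cong[OF assms(1), of "\<lambda>x. ddir v f x" "f' v"] by blast
  with assms(2) show ?thesis by (auto simp: differentiable_def)
qed

lemma Ck_on_Suc_derivative:
  "Ck_on (Suc k) f U \<Longrightarrow> x \<in> U \<Longrightarrow> (f has_derivative (\<lambda>v. ddir v f x)) (at x)"
  by (rule has_derivative_ddir) simp

lemma Ck_on_add:
  assumes "open U" "Ck_on k f U" "Ck_on k g U"
  shows "Ck_on k (\<lambda>x. f x + g x) U"
  using assms(2,3)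
proof (induction k arbitrary: f g)
  case 0
  then show ?case by (simp add: continuous_on_add)
next
  case (Suc k)
  show ?case
  proof (rule Ck_on_SucI[OF assms(1)])
    show "Ck_on k (\<lambda>x. ddir v f x + ddir v g x) U" for v
      using Suc.prems by (intro Suc.IH) auto
    show "((\<lambda>x. f x + g x) has_derivative (\<lambda>v. ddir v f x + ddir v g x)) (at x)" if "x \<in> U" for x
      by (intro has_derivative_add Ck_on_Suc_derivative[OF Suc.prems(1) that]
          Ck_on_Suc_derivative[OF Suc.prems(2) that])
  qed
qed

lemma Ck_on_mult:
  assumes "open U" "Ck_on k f U" "Ck_on k g U"
  shows "Ck_on k (\<lambda>x. f x * g x) U"
  using assms(2,3)
proof (induction k arbitrary: f g)
  case 0
  then show ?case by (simp add: continuous_on_mult)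
next
  case (Suc k)
  show ?case
  proof (rule Ck_on_SucI[OF assms(1)])
    show "Ck_on k (\<lambda>x. f x * ddir v g x + ddir v f x * g x) U" for v
      using Suc.prems Ck_on_Suc_imp[of k f U] Ck_on_Suc_imp[of k g U]
      by (intro Ck_on_add[OF assms(1)] Suc.IH) auto
    show "((\<lambda>x. f x * g x) has_derivative (\<lambda>v. f x * ddir v g x + ddir v f x * g x)) (at x)"
      if "x \<in> U" for x
      by (intro has_derivative_mult Ck_on_Suc_derivative[OF Suc.prems(1) that]
          Ck_on_Suc_derivative[OF Suc.prems(2) that])
  qed
qed

lemma Ck_on_inverse:
  assumes "open U" "Ck_on k f U" "\<And>x. x \<in> U \<Longrightarrow> f x \<noteq> 0"
  shows "Ck_on k (\<lambda>x. inverse (f x)) U"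
  using assms(2,3)
proof (induction k arbitrary: f)
  case 0
  then show ?case by (simp add: continuous_on_inverse)
next
  case (Suc k)
  show ?case
  proof (rule Ck_on_SucI[OF assms(1)])
    show "((\<lambda>x. inverse (f x)) has_derivative
        (\<lambda>v. - 1 * (inverse (f x) * ddir v f x * inverse (f x)))) (at x)" if "x \<in> U" for x
      using Deriv.has_derivative_inverse[OF _ Ck_on_Suc_derivative[OF Suc.prems(1) that]] Suc.prems that
      by simp
    show "Ck_on k (\<lambda>x. - 1 * (inverse (f x) * ddir v f x * inverse (f x))) U" for v
      using Suc.prems Ck_on_Suc_imp[of k f U]
      by (intro Ck_on_mult[OF assms(1)] Suc.IH Ck_on_const) auto
  qed
qed

lemma Ck_on_sqrt:
  assumes "open U" "Ck_on k f U" "\<And>x. x \<in> U \<Longrightarrow> f x > 0"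
  shows "Ck_on k (\<lambda>x. sqrt (f x)) U"
  using assms(2,3)
proof (induction k arbitrary: f)
  case 0
  then show ?case by (simp add: continuous_on_real_sqrt)
next
  case (Suc k)
  have nz: "sqrt (f x) \<noteq> 0" if "x \<in> U" for x
    using Suc.prems(2)[OF that] by simp
  show ?case
  proof (rule Ck_on_SucI[OF assms(1)])
    show "((\<lambda>x. sqrt (f x)) has_derivative
        (\<lambda>v. ddir v f x * (inverse (sqrt (f x)) * (1 / 2)))) (at x)" if "x \<in> U" for x
      using has_derivative_real_sqrt[OF _ Ck_on_Suc_derivative[OF Suc.prems(1) that]] Suc.prems(2)[OF that]
      by simp
    show "Ck_on k (\<lambda>x. ddir v f x * (inverse (sqrt (f x)) * (1 / 2))) U" for v
      using Suc.prems Ck_on_Suc_imp[of k f U] nz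
      by (intro Ck_on_mult[OF assms(1)] Ck_on_inverse[OF assms(1)] Suc.IH Ck_on_const) auto
  qed
qed

lemma Ck_on_compose_linear:
  assumes "open U" "open V" "bounded_linear h" "\<And>x. x \<in> V \<Longrightarrow> h x \<in> U" "Ck_on k f U"
  shows "Ck_on k (\<lambda>x. f (h x)) V"
  using assms(5)
proof (induction k arbitrary: f)
  case 0
  then have "continuous_on U f" by simp
  then show ?case using assms unfolding Ck_on.simps
    by (intro continuous_on_compose2[of U f V h] linear_continuous_on[of h]) auto
next
  case (Suc k)
  show ?case
  proof (rule Ck_on_SucI[OF assms(2)])
    show "((\<lambda>x. f (h x)) has_derivative (\<lambda>v. ddir (h v) f (h x))) (at x)" if "x \<in> V" for x
      using assms(4)[OF that]
      by (intro has_derivative_compose[OF bounded_linear_imp_has_derivative[OF assms(3)]]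
           Ck_on_Suc_derivative[OF Suc.prems])
    show "Ck_on k (\<lambda>x. ddir (h v) f (h x)) V" for v
      using Suc.prems by (intro Suc.IH) auto
  qed
qed

lemma smooth_on_differentiable:
  assumes "smooth_on f U" "x \<in> U"
  shows "f differentiable (at x)"
proof -
  have "Ck_on (Suc 0) f U" using assms(1) by (simp only: smooth_on_def)
  then show ?thesis using assms(2) by simp
qed

lemma smooth_on_ddir:
  assumes "smooth_on f U"
  shows "smooth_on (\<lambda>x. ddir v f x) U"
  unfolding smooth_on_def
proof
  fix k
  have "Ck_on (Suc k) f U" using assms by (simp only: smooth_on_def)
  then show "Ck_on k (\<lambda>x. ddir v f x) U" by simp
qed

lemma smooth_on_continuous:
  assumes "smooth_on f U"
  shows "continuous_on U f"
proof -
  have "Ck_on 0 f U" using assms by (simp only: smooth_on_def)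
  then show ?thesis by simp
qed

section \<open>Symmetry of second derivatives\<close>

text \<open>
  Partial derivatives and mean value arguments both live on lines, so this is the only instance of
  the chain rule that they need.
\<close>

lemma has_real_derivative_along_line:
  assumes "smooth_on g U" "w + s *\<^sub>R e \<in> U"
  shows "((\<lambda>s. g (w + s *\<^sub>R e)) has_real_derivative ddir e g (w + s *\<^sub>R e)) (at s)"
proof -
  have "((\<lambda>s. w + s *\<^sub>R e) has_derivative (\<lambda>r. r *\<^sub>R e)) (at s)"
    by (auto intro!: derivative_eq_intros)
  from has_derivative_compose[OF this has_derivative_ddir[OF smooth_on_differentiable[OF assms]]]
  have "((\<lambda>s. g (w + s *\<^sub>R e)) has_derivative (\<lambda>r. ddir (r *\<^sub>R e) g (w + s *\<^sub>R e))) (at s)" .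
  moreover have "ddir (r *\<^sub>R e) g (w + s *\<^sub>R e) = ddir e g (w + s *\<^sub>R e) * r" for r
    using linear_cmul[OF linear_frechet_derivative[OF smooth_on_differentiable[OF assms]], of r e]
    by simp
  ultimately show ?thesis by (simp add: has_field_derivative_def mult_commute_abs)
qed

text \<open>
  Two applications of the mean value theorem, first in direction \<open>u\<close> and then in direction \<open>v\<close>.
  The left-hand side is symmetric in \<open>u\<close> and \<open>v\<close>, which is what makes the mixed derivatives
  agree in the limit \<open>h \<rightarrow> 0\<close>.
\<close>

lemma second_difference_mean_value:
  fixes f :: "'a::euclidean_space \<Rightarrow> real"
  assumes f: "smooth_on f U" and h: "h > 0"
    and sub: "\<And>s t. 0 \<le> s \<Longrightarrow> s \<le> h \<Longrightarrow> 0 \<le> t \<Longrightarrow> t \<le> h \<Longrightarrow> z + s *\<^sub>R u + t *\<^sub>R v \<in> U"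
  obtains s t where "0 < s" "s < h" "0 < t" "t < h"
    "f (z + h *\<^sub>R u + h *\<^sub>R v) - f (z + h *\<^sub>R u) - f (z + h *\<^sub>R v) + f z
       = h\<^sup>2 * ddir v (\<lambda>x. ddir u f x) (z + s *\<^sub>R u + t *\<^sub>R v)"
proof -
  note line = has_real_derivative_along_line
  let ?p = "\<lambda>s. f ((z + h *\<^sub>R v) + s *\<^sub>R u) - f (z + s *\<^sub>R u)"
  have "(?p has_real_derivative (ddir u f ((z + h *\<^sub>R v) + s *\<^sub>R u) - ddir u f (z + s *\<^sub>R u))) (at s)"
    if "0 \<le> s" "s \<le> h" for s
    using sub[of s h] sub[of s 0] that h
    by (intro DERIV_diff line[OF f]) (auto simp: algebra_simps)
  from MVT2[of 0 h ?p, OF h this] obtain s where s: "0 < s" "s < h"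
    and s_eq: "?p h - ?p 0 = h * (ddir u f ((z + h *\<^sub>R v) + s *\<^sub>R u) - ddir u f (z + s *\<^sub>R u))"
    by auto
  let ?q = "\<lambda>t. ddir u f ((z + s *\<^sub>R u) + t *\<^sub>R v)"
  have "(?q has_real_derivative ddir v (\<lambda>x. ddir u f x) ((z + s *\<^sub>R u) + t *\<^sub>R v)) (at t)"
    if "0 \<le> t" "t \<le> h" for t
    using sub[of s t] that s by (intro line[OF smooth_on_ddir[OF f]]) auto
  from MVT2[of 0 h ?q, OF h this] obtain t where t: "0 < t" "t < h"
    and t_eq: "?q h - ?q 0 = h * ddir v (\<lambda>x. ddir u f x) ((z + s *\<^sub>R u) + t *\<^sub>R v)"
    by auto
  have "f (z + h *\<^sub>R u + h *\<^sub>R v) - f (z + h *\<^sub>R u) - f (z + h *\<^sub>R v) + f z = ?p h - ?p 0"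
    by (simp add: add_ac)
  also have "\<dots> = h * (?q h - ?q 0)"
    unfolding s_eq by (simp add: add_ac)
  also have "\<dots> = h\<^sup>2 * ddir v (\<lambda>x. ddir u f x) (z + s *\<^sub>R u + t *\<^sub>R v)"
    unfolding t_eq by (simp add: power2_eq_square)
  finally show thesis using that s t by blast
qed

lemma ddir_commute:
  fixes f :: "'a::euclidean_space \<Rightarrow> real"
  assumes f: "smooth_on f U" and U: "open U" "z \<in> U"
  shows "ddir v (\<lambda>x. ddir u f x) z = ddir u (\<lambda>x. ddir v f x) z"
proof (rule ccontr)
  let ?A = "\<lambda>x. ddir v (\<lambda>x. ddir u f x) x" and ?B = "\<lambda>x. ddir u (\<lambda>x. ddir v f x) x"
  assume neq: "?A z \<noteq> ?B z"
  define e where "e = \<bar>?A z - ?B z\<bar> / 2"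
  have e: "e > 0" using neq by (simp add: e_def)
  have "isCont ?A z" "isCont ?B z"
    using f U by (auto intro!: continuous_on_interior[OF smooth_on_continuous[of _ U]]
      smooth_on_ddir simp: interior_open)
  then obtain d1 d2 where d: "d1 > 0" "d2 > 0"
    "\<And>x. dist x z < d1 \<Longrightarrow> dist (?A x) (?A z) < e" "\<And>x. dist x z < d2 \<Longrightarrow> dist (?B x) (?B z) < e"
    using e unfolding continuous_at_eps_delta by metis
  obtain d3 where d3: "d3 > 0" "\<And>x. dist x z < d3 \<Longrightarrow> x \<in> U"
    using U by (meson openE mem_ball dist_commute subsetD open_dist)
  define d where "d = min d1 (min d2 d3)"
  define h where "h = d / (2 * (norm u + norm v + 1))"
  have pos: "d > 0" using d d3 by (simp add: d_def)
  have h: "h > 0" using pos by (auto simp: h_def intro!: divide_pos_pos add_nonneg_pos)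
  have near: "dist (z + s *\<^sub>R p + t *\<^sub>R q) z < d"
    if "0 \<le> s" "s \<le> h" "0 \<le> t" "t \<le> h" "norm p + norm q = norm u + norm v" for s t p q
  proof -
    have "dist (z + s *\<^sub>R p + t *\<^sub>R q) z \<le> s * norm p + t * norm q"
      using that norm_triangle_ineq[of "s *\<^sub>R p" "t *\<^sub>R q"] by (simp add: dist_norm algebra_simps)
    also have "\<dots> \<le> h * norm p + h * norm q"
      using that by (intro add_mono mult_right_mono) auto
    also have "\<dots> = h * (norm u + norm v)" by (simp flip: that(5) add: algebra_simps)
    also have "\<dots> < h * (2 * (norm u + norm v + 1))"
      using h by (intro mult_strict_left_mono) (auto intro: add_nonneg_pos simp: add_nonneg_pos)
    also have "\<dots> = d"
      using add_nonneg_pos[of "norm u + norm v" 1] by (simp add: h_def)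
    finally show ?thesis .
  qed
  obtain s t where st: "0 < s" "s < h" "0 < t" "t < h"
    "f (z + h *\<^sub>R u + h *\<^sub>R v) - f (z + h *\<^sub>R u) - f (z + h *\<^sub>R v) + f z = h\<^sup>2 * ?A (z + s *\<^sub>R u + t *\<^sub>R v)"
    using second_difference_mean_value[OF f h, of z u v] near d3 unfolding d_def by auto
  obtain s' t' where st': "0 < s'" "s' < h" "0 < t'" "t' < h"
    "f (z + h *\<^sub>R v + h *\<^sub>R u) - f (z + h *\<^sub>R v) - f (z + h *\<^sub>R u) + f z = h\<^sup>2 * ?B (z + s' *\<^sub>R v + t' *\<^sub>R u)"
    using second_difference_mean_value[OF f h, of z v u] near d3 unfolding d_def by auto
  have "h\<^sup>2 * ?A (z + s *\<^sub>R u + t *\<^sub>R v) = h\<^sup>2 * ?B (z + s' *\<^sub>R v + t' *\<^sub>R u)"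
    unfolding st(5)[symmetric] st'(5)[symmetric] by (simp add: add_ac)
  then have "?A (z + s *\<^sub>R u + t *\<^sub>R v) = ?B (z + s' *\<^sub>R v + t' *\<^sub>R u)" using h by simp
  moreover have "dist (?A (z + s *\<^sub>R u + t *\<^sub>R v)) (?A z) < e"
    using near[of s t u v] st d unfolding d_def by auto
  moreover have "dist (?B (z + s' *\<^sub>R v + t' *\<^sub>R u)) (?B z) < e"
    using near[of s' t' v u] st' d unfolding d_def by auto
  ultimately have "\<bar>?A z - ?B z\<bar> < 2 * e" by (simp add: dist_real_def)
  then show False by (simp add: e_def)
qed

section \<open>Partial derivatives on phase space\<close>

locale phase_region =
  fixes C :: "((real ^ 'n::finite) \<times> (real ^ 'n)) set"
  assumes open_region: "open C"
begin

abbreviation smooth :: "'n phase_fun \<Rightarrow> bool" where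
  "smooth \<equiv> smooth_phase C"

abbreviation pd :: "(real ^ 'n) \<times> (real ^ 'n) \<Rightarrow> 'n phase_fun \<Rightarrow> 'n phase_fun" where
  "pd w f x y \<equiv> ddir w (case_prod f) (x, y)"

lemma smooth_iff: "smooth f \<longleftrightarrow> (\<forall>k. Ck_on k (\<lambda>z. f (fst z) (snd z)) C)"
  by (simp add: smooth_phase_def smooth_on_def split_beta')

lemma smooth_cong: "(\<And>x y. (x, y) \<in> C \<Longrightarrow> f x y = g x y) \<Longrightarrow> smooth f \<longleftrightarrow> smooth g"
  unfolding smooth_iff
  using Ck_on_cong[OF open_region, of "\<lambda>z. f (fst z) (snd z)" "\<lambda>z. g (fst z) (snd z)"] by auto

lemma smooth_subset: "smooth f \<Longrightarrow> C' \<subseteq> C \<Longrightarrow> smooth_phase C' f"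
  unfolding smooth_phase_def smooth_on_def using Ck_on_subset by blast

lemma smooth_const [simp]: "smooth (\<lambda>x y. c)"
  by (simp add: smooth_iff Ck_on_const)

lemma smooth_add [simp]: "smooth f \<Longrightarrow> smooth g \<Longrightarrow> smooth (\<lambda>x y. f x y + g x y)"
  by (simp add: smooth_iff Ck_on_add open_region)

lemma smooth_mult [simp]: "smooth f \<Longrightarrow> smooth g \<Longrightarrow> smooth (\<lambda>x y. f x y * g x y)"
  by (simp add: smooth_iff Ck_on_mult open_region)

lemma smooth_divide [simp]: "smooth f \<Longrightarrow> smooth (\<lambda>x y. f x y / c)"
  using smooth_mult[of f "\<lambda>x y. inverse c"] by (simp add: divide_inverse)

lemma smooth_minus [simp]: "smooth f \<Longrightarrow> smooth (\<lambda>x y. - f x y)"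
  using smooth_mult[of "\<lambda>x y. - 1" f] by simp

lemma smooth_diff [simp]: "smooth f \<Longrightarrow> smooth g \<Longrightarrow> smooth (\<lambda>x y. f x y - g x y)"
  using smooth_add[of f "\<lambda>x y. - g x y"] by simp

lemma smooth_power [simp]: "smooth f \<Longrightarrow> smooth (\<lambda>x y. f x y ^ m)"
  by (induction m) auto

lemma smooth_sum [simp]: "(\<And>i. i \<in> I \<Longrightarrow> smooth (f i)) \<Longrightarrow> smooth (\<lambda>x y. \<Sum>i\<in>I. f i x y)"
  by (induction I rule: infinite_finite_induct) auto

lemma smooth_inverse:
  "smooth f \<Longrightarrow> (\<And>x y. (x, y) \<in> C \<Longrightarrow> f x y \<noteq> 0) \<Longrightarrow> smooth (\<lambda>x y. inverse (f x y))"
  unfolding smooth_iff using Ck_on_inverse[OF open_region, of _ "\<lambda>z. f (fst z) (snd z)"] by auto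

lemma smooth_sqrt:
  "smooth f \<Longrightarrow> (\<And>x y. (x, y) \<in> C \<Longrightarrow> f x y > 0) \<Longrightarrow> smooth (\<lambda>x y. sqrt (f x y))"
  unfolding smooth_iff using Ck_on_sqrt[OF open_region, of _ "\<lambda>z. f (fst z) (snd z)"] by auto

lemma smooth_fibre_coord [simp]: "smooth (\<lambda>x y. y $ i)"
  unfolding smooth_iff
  using Ck_on_bounded_linear[OF bounded_linear_compose[OF bounded_linear_vec_nth bounded_linear_snd]]
  by blast

lemma has_derivative_phase:
  assumes "smooth f" "(x, y) \<in> C"
  shows "(case_prod f has_derivative (\<lambda>w. pd w f x y)) (at (x, y))"
  using assms has_derivative_ddir[OF smooth_on_differentiable] unfolding smooth_phase_def by blast

lemma pd_add_direction:
  "smooth f \<Longrightarrow> (x, y) \<in> C \<Longrightarrow> pd (v + w) f x y = pd v f x y + pd w f x y"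
  using linear_add[OF has_derivative_linear[OF has_derivative_phase]] by blast

lemma pd_scale_direction:
  "smooth f \<Longrightarrow> (x, y) \<in> C \<Longrightarrow> pd (s *\<^sub>R w) f x y = s * pd w f x y"
  using linear_cmul[OF has_derivative_linear[OF has_derivative_phase], of f x y s w] by simp

lemma pd_along:
  assumes "smooth f" "(x + s *\<^sub>R u, y + s *\<^sub>R v) \<in> C"
  shows "((\<lambda>s. f (x + s *\<^sub>R u) (y + s *\<^sub>R v)) has_real_derivative
      pd (u, v) f (x + s *\<^sub>R u) (y + s *\<^sub>R v)) (at s)"
  using has_real_derivative_along_line[of "case_prod f" C "(x, y)" s "(u, v)"] assms
  by (simp add: smooth_phase_def)

lemma dx_eq_pd: "smooth f \<Longrightarrow> (x, y) \<in> C \<Longrightarrow> dx k f x y = pd (axis k 1, 0) f x y"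
  unfolding dx_def using pd_along[of f x 0 "axis k 1" y 0] by (simp add: DERIV_imp_deriv)

lemma dy_eq_pd: "smooth f \<Longrightarrow> (x, y) \<in> C \<Longrightarrow> dy k f x y = pd (0, axis k 1) f x y"
  unfolding dy_def using pd_along[of f x 0 0 y "axis k 1"] by (simp add: DERIV_imp_deriv)

lemma pd_vertical:
  assumes "smooth f" "(x, y) \<in> C"
  shows "pd (0, v) f x y = (\<Sum>k\<in>UNIV. v $ k * dy k f x y)"
proof -
  have "(0::real ^ 'n, v) = (\<Sum>k\<in>UNIV. v $ k *\<^sub>R (0, axis k 1))"
    by (simp add: prod_eq_iff fst_sum snd_sum basis_expansion flip: scalar_mult_eq_scaleR)
  then have "pd (0, v) f x y = (\<Sum>k\<in>UNIV. pd (v $ k *\<^sub>R (0, axis k 1)) f x y)"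
    using linear_sum[OF has_derivative_linear[OF has_derivative_phase[OF assms]]] by metis
  then show ?thesis
    using assms by (simp only: pd_scale_direction dy_eq_pd)
qed

lemma smooth_pd: "smooth f \<Longrightarrow> smooth (\<lambda>x y. pd w f x y)"
  unfolding smooth_phase_def using smooth_on_ddir[of "case_prod f" C w] by (simp add: split_beta')

lemma smooth_dx [simp]: "smooth f \<Longrightarrow> smooth (dx k f)"
  using smooth_cong[of "dx k f" "\<lambda>x y. pd (axis k 1, 0) f x y"] dx_eq_pd smooth_pd by blast

lemma smooth_dy [simp]: "smooth f \<Longrightarrow> smooth (dy k f)"
  using smooth_cong[of "dy k f" "\<lambda>x y. pd (0, axis k 1) f x y"] dy_eq_pd smooth_pd by blast

lemma eventually_in_region:
  assumes "(x, y) \<in> C"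
  shows "\<forall>\<^sub>F t in nhds (0::real). (x + t *\<^sub>R u, y + t *\<^sub>R v) \<in> C"
proof -
  have "isCont (\<lambda>t::real. (x + t *\<^sub>R u, y + t *\<^sub>R v)) 0"
    by (intro continuous_intros)
  then have "((\<lambda>t::real. (x + t *\<^sub>R u, y + t *\<^sub>R v)) \<longlongrightarrow> (x, y)) (nhds 0)"
    by (simp add: continuous_at tendsto_nhds_iff)
  from topological_tendstoD[OF this open_region assms] show ?thesis .
qed

lemma
  assumes xy: "(x, y) \<in> C" and eq: "\<And>x y. (x, y) \<in> C \<Longrightarrow> f x y = g x y"
  shows dx_cong: "dx k f x y = dx k g x y" and dy_cong: "dy k f x y = dy k g x y"
proof -
  have "\<forall>\<^sub>F t in nhds 0. f (x + t *\<^sub>R axis k 1) y = g (x + t *\<^sub>R axis k 1) y"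
    using eventually_in_region[OF xy, of "axis k 1" 0] by (rule eventually_mono) (simp add: eq)
  then show "dx k f x y = dx k g x y"
    unfolding dx_def by (rule deriv_cong_ev) simp
  have "\<forall>\<^sub>F t in nhds 0. f x (y + t *\<^sub>R axis k 1) = g x (y + t *\<^sub>R axis k 1)"
    using eventually_in_region[OF xy, of 0 "axis k 1"] by (rule eventually_mono) (simp add: eq)
  then show "dy k f x y = dy k g x y"
    unfolding dy_def by (rule deriv_cong_ev) simp
qed

lemma pd_commute:
  assumes "smooth f" "(x, y) \<in> C"
  shows "pd v (\<lambda>x y. pd w f x y) x y = pd w (\<lambda>x y. pd v f x y) x y"
  using ddir_commute[of "case_prod f" C "(x, y)" v w] assms open_region
  by (simp add: smooth_phase_def split_beta')

lemma
  assumes "smooth f" "(x, y) \<in> C"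
  shows dx_dx_commute: "dx j (dx k f) x y = dx k (dx j f) x y"
    and dx_dy_commute: "dx j (dy k f) x y = dy k (dx j f) x y"
    and dy_dy_commute: "dy j (dy k f) x y = dy k (dy j f) x y"
proof -
  have *: "dx j (dx k f) x y = pd (axis j 1, 0) (\<lambda>x y. pd (axis k 1, 0) f x y) x y"
    "dx j (dy k f) x y = pd (axis j 1, 0) (\<lambda>x y. pd (0, axis k 1) f x y) x y"
    "dy j (dx k f) x y = pd (0, axis j 1) (\<lambda>x y. pd (axis k 1, 0) f x y) x y"
    "dy j (dy k f) x y = pd (0, axis j 1) (\<lambda>x y. pd (0, axis k 1) f x y) x y" for j k
    using dx_cong[OF assms(2), of "dx k f" "\<lambda>x y. pd (axis k 1, 0) f x y", OF dx_eq_pd[OF assms(1)]]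
      dx_cong[OF assms(2), of "dy k f" "\<lambda>x y. pd (0, axis k 1) f x y", OF dy_eq_pd[OF assms(1)]]
      dy_cong[OF assms(2), of "dx k f" "\<lambda>x y. pd (axis k 1, 0) f x y", OF dx_eq_pd[OF assms(1)]]
      dy_cong[OF assms(2), of "dy k f" "\<lambda>x y. pd (0, axis k 1) f x y", OF dy_eq_pd[OF assms(1)]]
      dx_eq_pd[OF smooth_pd[OF assms(1)] assms(2)] dy_eq_pd[OF smooth_pd[OF assms(1)] assms(2)]
    by metis+
  show "dx j (dx k f) x y = dx k (dx j f) x y" "dx j (dy k f) x y = dy k (dx j f) x y"
    "dy j (dy k f) x y = dy k (dy j f) x y"
    unfolding * using pd_commute[OF assms] by blast+
qed

lemma
  assumes "smooth f" "(x, y) \<in> C"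
  shows DERIV_dx: "((\<lambda>t. f (x + t *\<^sub>R axis k 1) y) has_real_derivative dx k f x y) (at 0)"
    and DERIV_dy: "((\<lambda>t. f x (y + t *\<^sub>R axis k 1)) has_real_derivative dy k f x y) (at 0)"
  using pd_along[of f x 0 "axis k 1" y 0] pd_along[of f x 0 0 y "axis k 1"] assms
  by (simp_all add: dx_eq_pd dy_eq_pd)

lemma dx_eqI: "((\<lambda>t. f (x + t *\<^sub>R axis k 1) y) has_real_derivative d) (at 0) \<Longrightarrow> dx k f x y = d"
  and dy_eqI: "((\<lambda>t. f x (y + t *\<^sub>R axis k 1)) has_real_derivative d) (at 0) \<Longrightarrow> dy k f x y = d"
  by (simp_all add: dx_def dy_def DERIV_imp_deriv)

lemma
  shows dx_const [simp]: "dx k (\<lambda>x y. c) x y = 0"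
    and dy_const [simp]: "dy k (\<lambda>x y. c) x y = 0"
    and dx_fibre_coord [simp]: "dx k (\<lambda>x y. y $ i) x y = 0"
    and dy_fibre_coord [simp]: "dy k (\<lambda>x y. y $ i) x y = of_bool (i = k)"
  by (auto intro!: dx_eqI dy_eqI derivative_eq_intros simp: axis_def)

lemma
  assumes f: "smooth f" and g: "smooth g" and xy: "(x, y) \<in> C"
  shows dx_add [simp]: "dx k (\<lambda>x y. f x y + g x y) x y = dx k f x y + dx k g x y"
    and dx_diff [simp]: "dx k (\<lambda>x y. f x y - g x y) x y = dx k f x y - dx k g x y"
    and dx_mult [simp]: "dx k (\<lambda>x y. f x y * g x y) x y = dx k f x y * g x y + f x y * dx k g x y"
    and dy_add [simp]: "dy k (\<lambda>x y. f x y + g x y) x y = dy k f x y + dy k g x y"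
    and dy_diff [simp]: "dy k (\<lambda>x y. f x y - g x y) x y = dy k f x y - dy k g x y"
    and dy_mult [simp]: "dy k (\<lambda>x y. f x y * g x y) x y = dy k f x y * g x y + f x y * dy k g x y"
  by (auto intro!: dx_eqI dy_eqI derivative_eq_intros DERIV_dx[OF f xy] DERIV_dx[OF g xy]
      DERIV_dy[OF f xy] DERIV_dy[OF g xy])

lemma
  assumes f: "smooth f" and xy: "(x, y) \<in> C"
  shows dx_minus [simp]: "dx k (\<lambda>x y. - f x y) x y = - dx k f x y"
    and dy_minus [simp]: "dy k (\<lambda>x y. - f x y) x y = - dy k f x y"
    and dx_divide [simp]: "dx k (\<lambda>x y. f x y / c) x y = dx k f x y / c"
    and dy_divide [simp]: "dy k (\<lambda>x y. f x y / c) x y = dy k f x y / c"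
    and dx_power [simp]: "dx k (\<lambda>x y. f x y ^ m) x y = real m * f x y ^ (m - 1) * dx k f x y"
    and dy_power [simp]: "dy k (\<lambda>x y. f x y ^ m) x y = real m * f x y ^ (m - 1) * dy k f x y"
  by (auto intro!: dx_eqI dy_eqI derivative_eq_intros DERIV_cdivide DERIV_dx[OF f xy] DERIV_dy[OF f xy])

lemma
  assumes f: "smooth f" and xy: "(x, y) \<in> C" and nz: "f x y \<noteq> 0"
  shows dx_inverse: "dx k (\<lambda>x y. inverse (f x y)) x y = - dx k f x y / (f x y)\<^sup>2"
    and dy_inverse: "dy k (\<lambda>x y. inverse (f x y)) x y = - dy k f x y / (f x y)\<^sup>2"
  using nz by (auto intro!: dx_eqI dy_eqI derivative_eq_intros DERIV_dx[OF f xy] DERIV_dy[OF f xy]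
      simp: power2_eq_square divide_inverse ac_simps)

lemma
  assumes "\<And>i. i \<in> I \<Longrightarrow> smooth (f i)" and xy: "(x, y) \<in> C"
  shows dx_sum [simp]: "dx k (\<lambda>x y. \<Sum>i\<in>I. f i x y) x y = (\<Sum>i\<in>I. dx k (f i) x y)"
    and dy_sum [simp]: "dy k (\<lambda>x y. \<Sum>i\<in>I. f i x y) x y = (\<Sum>i\<in>I. dy k (f i) x y)"
  by (intro dx_eqI dy_eqI DERIV_sum DERIV_dx[OF assms(1) xy] DERIV_dy[OF assms(1) xy]; assumption)+

text \<open>
  Differentiating \<open>f x (s *\<^sub>R y) = s ^ d * f x y\<close> in \<open>s\<close> at \<open>s = 1\<close>; the parameter is shifted
  to \<open>1 + s\<close> so that the line starts at \<open>y\<close>.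
\<close>

lemma euler:
  assumes "smooth f" "pos_homogeneous d C f" "(x, y) \<in> C"
  shows "(\<Sum>k\<in>UNIV. y $ k * dy k f x y) = d * f x y"
proof -
  have "((\<lambda>s. f (x + s *\<^sub>R 0) (y + s *\<^sub>R y)) has_real_derivative pd (0, y) f x y) (at 0)"
    using pd_along[of f x 0 0 y y] assms by simp
  moreover have "((\<lambda>s. f (x + s *\<^sub>R 0) (y + s *\<^sub>R y)) has_real_derivative d * f x y) (at 0)"
  proof (rule iffD1[OF DERIV_cong_ev])
    show "((\<lambda>s. (1 + s) ^ d * f x y) has_real_derivative d * f x y) (at 0)"
      by (auto intro!: derivative_eq_intros)
    have "\<forall>\<^sub>F s in nhds (0::real). s > - 1"
      by (intro order_tendstoD[of "\<lambda>s. s" 0]) (auto intro: filterlim_ident)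
    then show "\<forall>\<^sub>F s in nhds 0. (1 + s) ^ d * f x y = f (x + s *\<^sub>R 0) (y + s *\<^sub>R y)"
    proof (rule eventually_mono)
      fix s :: real assume "s > - 1"
      then have "f x ((1 + s) *\<^sub>R y) = (1 + s) ^ d * f x y"
        using assms(2,3) unfolding pos_homogeneous_def by force
      then show "(1 + s) ^ d * f x y = f (x + s *\<^sub>R 0) (y + s *\<^sub>R y)"
        by (simp add: scaleR_add_left)
    qed
  qed auto
  ultimately have "pd (0, y) f x y = d * f x y" by (rule DERIV_unique)
  then show ?thesis using pd_vertical[OF assms(1,3), of y] by simp
qed

lemma pos_homogeneous_dy:
  assumes f: "smooth f" "pos_homogeneous (Suc d) C f"
    and cone: "\<And>x y s. (x, y) \<in> C \<Longrightarrow> s > 0 \<Longrightarrow> (x, s *\<^sub>R y) \<in> C"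
  shows "pos_homogeneous d C (dy k f)"
  unfolding pos_homogeneous_def
proof clarify
  fix x y :: "real ^ 'n" and s :: real
  assume xy: "(x, y) \<in> C" and s: "s > 0"
  have "((\<lambda>t. f x (s *\<^sub>R y + t *\<^sub>R (s *\<^sub>R axis k 1))) has_real_derivative pd (0, s *\<^sub>R axis k 1) f x (s *\<^sub>R y)) (at 0)"
    using pd_along[of f x 0 0 "s *\<^sub>R y" "s *\<^sub>R axis k 1"] f cone[OF xy s] by simp
  moreover have "pd (0, s *\<^sub>R axis k 1) f x (s *\<^sub>R y) = s * dy k f x (s *\<^sub>R y)"
    using pd_scale_direction[OF f(1) cone[OF xy s], of s "(0, axis k 1)"] dy_eq_pd[OF f(1) cone[OF xy s]]
    by simp
  moreover have "\<forall>\<^sub>F t in nhds 0. f x (s *\<^sub>R y + t *\<^sub>R (s *\<^sub>R axis k 1)) = s ^ Suc d * f x (y + t *\<^sub>R axis k 1)"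
    using eventually_in_region[OF xy, of 0 "axis k 1"]
  proof (rule eventually_mono)
    fix t :: real assume "(x + t *\<^sub>R 0, y + t *\<^sub>R axis k 1) \<in> C"
    then have "f x (s *\<^sub>R (y + t *\<^sub>R axis k 1)) = s ^ Suc d * f x (y + t *\<^sub>R axis k 1)"
      using f(2) s unfolding pos_homogeneous_def by force
    then show "f x (s *\<^sub>R y + t *\<^sub>R (s *\<^sub>R axis k 1)) = s ^ Suc d * f x (y + t *\<^sub>R axis k 1)"
      by (simp add: scaleR_add_right mult.commute)
  qed
  ultimately have "((\<lambda>t. s ^ Suc d * f x (y + t *\<^sub>R axis k 1)) has_real_derivative s * dy k f x (s *\<^sub>R y)) (at 0)"
    using DERIV_cong_ev[of 0 0 "\<lambda>t. f x (s *\<^sub>R y + t *\<^sub>R (s *\<^sub>R axis k 1))"] by simp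
  moreover have "((\<lambda>t. s ^ Suc d * f x (y + t *\<^sub>R axis k 1)) has_real_derivative s ^ Suc d * dy k f x y) (at 0)"
    by (intro DERIV_cmult DERIV_dy f xy)
  ultimately have "s * dy k f x (s *\<^sub>R y) = s ^ Suc d * dy k f x y" by (rule DERIV_unique)
  then show "dy k f x (s *\<^sub>R y) = s ^ d * dy k f x y" using s by simp
qed

end

section \<open>Sprays proportional to the position vector\<close>

text \<open>
  Subtracting, a multiple of the identity equals an operator of rank at most one, so both vanish
  in dimension at least two. This is what makes $R$ and $\tau$ functions of the spray alone.
\<close>

lemma isotropic_operator_unique:
  fixes y :: "real ^ 'n::finite"
  assumes card: "CARD('n) \<ge> 2" and y: "y \<noteq> 0"
    and eq: "\<And>i k. r * of_bool (i = k) - t k * y $ i = r' * of_bool (i = k) - t' k * y $ i"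
  shows "t k = t' k"
proof -
  obtain i where i: "y $ i \<noteq> 0" using y by (metis vec_eq_iff zero_index)
  have off: "t j = t' j" if "j \<noteq> i" for j
    using eq[of i j] that i by simp
  have "\<exists>j. j \<noteq> i"
  proof (rule ccontr)
    assume "\<nexists>j. j \<noteq> i"
    then have "UNIV = {i}" by auto
    then have "CARD('n) = 1" by (metis card_1_singleton_iff One_nat_def)
    with card show False by simp
  qed
  then obtain j where j: "j \<noteq> i" by blast
  have "r = r'" using eq[of j j] off[OF j] by simp
  then have "t i = t' i" using eq[of i i] i by simp
  with off show ?thesis by metis
qed

locale conical_phase_region = phase_region C
  for C :: "((real ^ 'n::finite) \<times> (real ^ 'n)) set" +
  assumes cone: "(x, y) \<in> C \<Longrightarrow> s > 0 \<Longrightarrow> (x, s *\<^sub>R y) \<in> C"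
begin

abbreviation homogeneous :: "nat \<Rightarrow> 'n phase_fun \<Rightarrow> bool" where
  "homogeneous d \<equiv> pos_homogeneous d C"

lemma homogeneous_dy: "smooth f \<Longrightarrow> homogeneous (Suc d) f \<Longrightarrow> homogeneous d (dy k f)"
  using pos_homogeneous_dy cone by blast

lemma euler_dy:
  assumes "smooth f" "homogeneous (Suc d) f" "(x, y) \<in> C"
  shows "(\<Sum>j\<in>UNIV. y $ j * dy j (dy k f) x y) = d * dy k f x y"
  using euler[OF _ homogeneous_dy[OF assms(1,2)] assms(3)] assms(1) by simp

text \<open>
  The operators \<open>dx k\<close> respect vertical homogeneity; differentiating Euler's relation itself gives
  this in the form in which it is needed.
\<close>

lemma euler_dx:
  assumes "smooth f" "homogeneous d f" "(x, y) \<in> C"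
  shows "(\<Sum>j\<in>UNIV. y $ j * dy j (dx k f) x y) = d * dx k f x y"
proof -
  have "dx k (\<lambda>x y. \<Sum>j\<in>UNIV. y $ j * dy j f x y) x y = dx k (\<lambda>x y. real d * f x y) x y"
    using euler[OF assms(1,2)] by (intro dx_cong[OF assms(3)])
  then show ?thesis using assms by (simp add: dx_dy_commute)
qed

definition spray_deriv :: "'n phase_fun \<Rightarrow> 'n phase_fun" where
  "spray_deriv f x y = (\<Sum>j\<in>UNIV. y $ j * dx j f x y)"

text \<open>
  Hamel's equation $y^j P_{x^j y^k} = P_{x^k}$. For $P$ of degree one it says that
  $(y^j P_{x^j})_{y^k} = 2 P_{x^k}$, which is exactly what makes the curvature of the spray $P y^i$
  isotropic.
\<close>

definition hamel :: "'n phase_fun \<Rightarrow> bool" where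
  "hamel P \<longleftrightarrow> (\<forall>(x, y)\<in>C. \<forall>k. (\<Sum>j\<in>UNIV. y $ j * dx j (dy k P) x y) = dx k P x y)"

text \<open>
  For a function of degree two the Berwald connection of the spray $P y^i$ turns $L_{;k} = 0$ into
  the condition below, because $G^r{}_k L_{y^r} = (P_{y^k} y^r + P \delta^r_k) L_{y^r}
  = 2 P_{y^k} L + P L_{y^k}$.
\<close>

definition horizontally_constant :: "'n phase_fun \<Rightarrow> 'n phase_fun \<Rightarrow> bool" where
  "horizontally_constant P L \<longleftrightarrow>
     (\<forall>(x, y)\<in>C. \<forall>k. dx k L x y = 2 * dy k P x y * L x y + P x y * dy k L x y)"

lemma fund_tensor_nth:
  assumes "smooth L" "(x, y) \<in> C"
  shows "fund_tensor L x y $ i $ j = 1/2 * dy j (dy i L) x y"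
proof -
  have "dy j (dy i (\<lambda>x y. 1/2 * L x y)) x y = dy j (\<lambda>x y. 1/2 * dy i L x y) x y"
    using assms(1) by (intro dy_cong[OF assms(2)]) simp
  then show ?thesis using assms by (simp add: fund_tensor_def)
qed

lemma fund_tensor_square:
  assumes f: "smooth f" and xy: "(x, y) \<in> C"
  shows "fund_tensor (\<lambda>x y. (f x y)\<^sup>2) x y $ i $ j = dy i f x y * dy j f x y + f x y * dy j (dy i f) x y"
proof -
  have "dy j (dy i (\<lambda>x y. (f x y)\<^sup>2)) x y = dy j (\<lambda>x y. 2 * f x y * dy i f x y) x y"
    using f by (intro dy_cong[OF xy]) simp
  then show ?thesis
    using f xy by (simp add: fund_tensor_nth)
qed

text \<open>
  Euler's relation for \<open>dy i L\<close>, which has degree one.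
\<close>

lemma fund_tensor_position:
  assumes "smooth L" "homogeneous 2 L" "(x, y) \<in> C"
  shows "fund_tensor L x y *v y = (\<chi> i. 1/2 * dy i L x y)"
proof -
  have "(\<Sum>j\<in>UNIV. fund_tensor L x y $ i $ j * y $ j) = 1/2 * dy i L x y" for i
    using euler_dy[OF assms(1) _ assms(3), of 1 i] assms
    by (simp add: fund_tensor_nth mult.commute sum_divide_distrib[symmetric] numeral_2_eq_2)
  then show ?thesis by (simp add: matrix_vector_mult_def vec_eq_iff)
qed

text \<open>
  Multiplying by the fundamental tensor removes its inverse from the definition of the spray:
  $4 g_{il} p y^i = 2 p L_{y^l}$ by Euler's relation.
\<close>

lemma finsler_spray_eq_iff:
  assumes "smooth L" "homogeneous 2 L" "(x, y) \<in> C" "invertible (fund_tensor L x y)"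
  shows "finsler_spray L x y = p *\<^sub>R y \<longleftrightarrow>
    (\<forall>l. (\<Sum>k\<in>UNIV. y $ k * dy l (dx k L) x y) - dx l L x y = 2 * p * dy l L x y)"
proof -
  let ?g = "fund_tensor L x y"
  let ?E = "\<chi> l. (\<Sum>k\<in>UNIV. y $ k * dy l (dx k L) x y) - dx l L x y"
  have inv: "matrix_inv ?g ** ?g = mat 1" "?g ** matrix_inv ?g = mat 1"
    using someI_ex[OF assms(4)[unfolded invertible_def]] unfolding matrix_inv_def by blast+
  have fs: "finsler_spray L x y = (1/4) *\<^sub>R (matrix_inv ?g *v ?E)"
    by (simp add: finsler_spray_def matrix_vector_mult_def vec_eq_iff mult.commute)
  have "finsler_spray L x y = p *\<^sub>R y \<longleftrightarrow> matrix_inv ?g *v ?E = (4 * p) *\<^sub>R y"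
    unfolding fs by (auto simp: vec_eq_iff)
  also have "\<dots> \<longleftrightarrow> ?E = (4 * p) *\<^sub>R (?g *v y)"
  proof
    assume "matrix_inv ?g *v ?E = (4 * p) *\<^sub>R y"
    then have "?g *v (matrix_inv ?g *v ?E) = ?g *v ((4 * p) *\<^sub>R y)" by simp
    then show "?E = (4 * p) *\<^sub>R (?g *v y)"
      by (simp only: matrix_vector_mul_assoc inv matrix_vector_mul_lid
          linear_cmul[OF matrix_vector_mul_linear])
  next
    assume "?E = (4 * p) *\<^sub>R (?g *v y)"
    then have "matrix_inv ?g *v ?E = matrix_inv ?g *v ((4 * p) *\<^sub>R (?g *v y))" by simp
    then show "matrix_inv ?g *v ?E = (4 * p) *\<^sub>R y"
      by (simp only: matrix_vector_mul_assoc inv matrix_vector_mul_lid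
          linear_cmul[OF matrix_vector_mul_linear])
  qed
  also have "\<dots> \<longleftrightarrow> (\<forall>l. ?E $ l = 2 * p * dy l L x y)"
    unfolding fund_tensor_position[OF assms(1-3)] by (simp add: vec_eq_iff mult.assoc)
  finally show ?thesis by simp
qed

lemma dy_spray_deriv:
  assumes "smooth f" "(x, y) \<in> C"
  shows "dy l (spray_deriv f) x y = dx l f x y + (\<Sum>k\<in>UNIV. y $ k * dy l (dx k f) x y)"
proof -
  have "dy l (\<lambda>x y. \<Sum>k\<in>UNIV. y $ k * dx k f x y) x y
      = dx l f x y + (\<Sum>k\<in>UNIV. y $ k * dy l (dx k f) x y)"
    using assms by (simp add: sum.distrib of_bool_def if_distrib[of "\<lambda>z. z * _"] cong: if_cong)
  then show ?thesis
    by (simp add: spray_deriv_def[abs_def])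
qed

lemma smooth_spray_deriv [simp]: "smooth f \<Longrightarrow> smooth (spray_deriv f)"
  unfolding spray_deriv_def[abs_def] by simp

lemma spray_deriv_horizontally_constant:
  assumes "horizontally_constant P L" "homogeneous 1 P" "smooth P" "homogeneous 2 L" "smooth L" "(x, y) \<in> C"
  shows "spray_deriv L x y = 4 * P x y * L x y"
proof -
  have "spray_deriv L x y = (\<Sum>k\<in>UNIV. 2 * L x y * (y $ k * dy k P x y) + P x y * (y $ k * dy k L x y))"
    using assms(1,6) unfolding horizontally_constant_def spray_deriv_def
    by (intro sum.cong) (auto simp: algebra_simps)
  also have "\<dots> = 2 * L x y * P x y + P x y * (2 * L x y)"
    using euler[OF assms(3,2,6)] euler[OF assms(5,4,6)]
    by (simp add: sum.distrib sum_distrib_left[symmetric])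
  finally show ?thesis by simp
qed

text \<open>
  Let $D = y^k \partial_k$. The spray equation reads $(DL)_{y^l} - 2 L_{x^l} = 2 P L_{y^l}$.
  Contracted with $y^l$ it gives $DL = 4PL$, and with the vertical derivative of $DL = 4PL$ one
  solves for $L_{x^l}$. In the other direction $DL = 4PL$ comes from contracting the assumption
  with $y^k$, and the same vertical derivative gives the spray equation back.
\<close>

lemma finsler_spray_projective:
  assumes L: "smooth L" "homogeneous 2 L" and P: "smooth P" "homogeneous 1 P"
    and inv: "\<And>x y. (x, y) \<in> C \<Longrightarrow> invertible (fund_tensor L x y)"
  shows "(\<forall>(x, y)\<in>C. finsler_spray L x y = P x y *\<^sub>R y) \<longleftrightarrow> horizontally_constant P L"
proof
  assume "\<forall>(x, y)\<in>C. finsler_spray L x y = P x y *\<^sub>R y"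
  then have E: "(\<Sum>k\<in>UNIV. y $ k * dy l (dx k L) x y) - dx l L x y = 2 * P x y * dy l L x y"
    if "(x, y) \<in> C" for x y l
    using finsler_spray_eq_iff[OF L that inv[OF that]] that by fast
  have L0: "spray_deriv L x y = 4 * P x y * L x y" if xy: "(x, y) \<in> C" for x y
  proof -
    have "(\<Sum>l\<in>UNIV. y $ l * ((\<Sum>k\<in>UNIV. y $ k * dy l (dx k L) x y) - dx l L x y))
        = (\<Sum>l\<in>UNIV. 2 * P x y * (y $ l * dy l L x y))"
      using E[OF xy] by (simp add: algebra_simps)
    moreover have "(\<Sum>l\<in>UNIV. y $ l * (\<Sum>k\<in>UNIV. y $ k * dy l (dx k L) x y))
        = (\<Sum>k\<in>UNIV. y $ k * (\<Sum>l\<in>UNIV. y $ l * dy l (dx k L) x y))"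
      unfolding sum_distrib_left by (subst sum.swap) (simp add: mult_ac)
    moreover have "\<dots> = 2 * spray_deriv L x y"
      using euler_dx[OF L xy] by (simp add: spray_deriv_def sum_distrib_left mult_ac)
    ultimately show ?thesis
      using euler[OF L xy]
      by (simp add: right_diff_distrib sum_subtractf spray_deriv_def sum_distrib_left[symmetric])
  qed
  show "horizontally_constant P L"
    unfolding horizontally_constant_def
  proof clarify
    fix x y l assume xy: "(x, y) \<in> C"
    have "dy l (spray_deriv L) x y = dy l (\<lambda>x y. 4 * P x y * L x y) x y"
      by (intro dy_cong[OF xy] L0)
    then have "dx l L x y + (\<Sum>k\<in>UNIV. y $ k * dy l (dx k L) x y)
        = 4 * dy l P x y * L x y + 4 * P x y * dy l L x y"
      unfolding dy_spray_deriv[OF L(1) xy] using L P xy by simp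
    with E[OF xy, of l] show "dx l L x y = 2 * dy l P x y * L x y + P x y * dy l L x y"
      by simp
  qed
next
  assume hc: "horizontally_constant P L"
  show "\<forall>(x, y)\<in>C. finsler_spray L x y = P x y *\<^sub>R y"
  proof clarify
    fix x y assume xy: "(x, y) \<in> C"
    have "dy l (spray_deriv L) x y = dy l (\<lambda>x y. 4 * P x y * L x y) x y" for l
      using spray_deriv_horizontally_constant[OF hc P(2,1) L(2,1)] by (intro dy_cong[OF xy])
    then have "dx l L x y + (\<Sum>k\<in>UNIV. y $ k * dy l (dx k L) x y)
        = 4 * dy l P x y * L x y + 4 * P x y * dy l L x y" for l
      unfolding dy_spray_deriv[OF L(1) xy] using L P xy by simp
    then have "(\<Sum>k\<in>UNIV. y $ k * dy l (dx k L) x y)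
        = 4 * dy l P x y * L x y + 4 * P x y * dy l L x y - dx l L x y" for l
      by (simp add: eq_diff_eq add.commute)
    moreover have "dx l L x y = 2 * dy l P x y * L x y + P x y * dy l L x y" for l
      using hc xy unfolding horizontally_constant_def by fast
    ultimately have "(\<Sum>k\<in>UNIV. y $ k * dy l (dx k L) x y) - dx l L x y = 2 * P x y * dy l L x y" for l
      by simp
    then show "finsler_spray L x y = P x y *\<^sub>R y"
      using finsler_spray_eq_iff[OF L xy inv[OF xy]] by blast
  qed
qed

text \<open>
  The spray is known only on the region, so each derivative is taken of the explicit formula
  obtained there in the previous step.
\<close>

lemma coord_projective:
  assumes "\<And>x y. (x, y) \<in> C \<Longrightarrow> G x y = P x y *\<^sub>R y" and P: "smooth P" and xy: "(x, y) \<in> C"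
  shows "coord G i x y = P x y * y $ i"
    and "dx k (coord G i) x y = dx k P x y * y $ i"
    and "dy k (coord G i) x y = dy k P x y * y $ i + P x y * of_bool (i = k)"
    and "dx j (dy k (coord G i)) x y = dx j (dy k P) x y * y $ i + dx j P x y * of_bool (i = k)"
    and "dy j (dy k (coord G i)) x y = dy j (dy k P) x y * y $ i + dy k P x y * of_bool (i = j)
       + dy j P x y * of_bool (i = k)"
proof -
  have G: "coord G i x y = P x y * y $ i" if "(x, y) \<in> C" for x y
    using assms(1)[OF that] by (simp add: coord_def)
  have Gk: "dy k (coord G i) x y = dy k P x y * y $ i + P x y * of_bool (i = k)" if "(x, y) \<in> C" for x y
    using dy_cong[OF that G] P that by simp
  show "coord G i x y = P x y * y $ i" using G xy by simp
  show "dy k (coord G i) x y = dy k P x y * y $ i + P x y * of_bool (i = k)" using Gk xy by simp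
  show "dx k (coord G i) x y = dx k P x y * y $ i"
    using dx_cong[OF xy G] P xy by simp
  show "dx j (dy k (coord G i)) x y = dx j (dy k P) x y * y $ i + dx j P x y * of_bool (i = k)"
    using dx_cong[OF xy Gk] P xy by simp
  show "dy j (dy k (coord G i)) x y = dy j (dy k P) x y * y $ i + dy k P x y * of_bool (i = j)
       + dy j P x y * of_bool (i = k)"
    using dy_cong[OF xy Gk] P xy by simp
qed

lemma sum_of_bool: "(\<Sum>j\<in>UNIV. f j * of_bool (j = k)) = (f k :: real)"
  "(\<Sum>j\<in>UNIV. f j * of_bool (k = j)) = (f k :: real)" for k :: "'b::finite"
  by (simp_all add: of_bool_def if_distrib[of "\<lambda>z. _ * z"] cong: if_cong)

text \<open>
  Euler's relations reduce every sum over \<open>j\<close>: the functions \<open>P\<close>, \<open>dy k P\<close> have degrees one and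
  zero, and Hamel's equation handles the mixed derivatives.
\<close>

lemma riemann_curv_projective:
  assumes G: "\<And>x y. (x, y) \<in> C \<Longrightarrow> G x y = P x y *\<^sub>R y"
    and P: "smooth P" "homogeneous 1 P" "hamel P" and xy: "(x, y) \<in> C"
  shows "riemann_curv G i k x y = ((P x y)\<^sup>2 - spray_deriv P x y) * of_bool (i = k)
     - (P x y * dy k P x y - dx k P x y) * y $ i"
proof -
  note [simp] = coord_projective[OF G P(1) xy]
  have e1: "(\<Sum>j\<in>UNIV. y $ j * dy j P x y) = P x y"
    using euler[OF P(1,2) xy] by simp
  have e2: "(\<Sum>j\<in>UNIV. y $ j * dy j (dy k P) x y) = 0"
    using euler_dy[OF P(1) _ xy, of 0 k] P(2) by simp
  have e3: "(\<Sum>j\<in>UNIV. y $ j * dx j (dy k P) x y) = dx k P x y"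
    using P(3) xy unfolding hamel_def by fast
  have s1: "(\<Sum>j\<in>UNIV. y $ j * dx j (dy k (coord G i)) x y)
      = dx k P x y * y $ i + spray_deriv P x y * of_bool (i = k)"
    by (simp add: distrib_left sum.distrib spray_deriv_def sum_distrib_right flip: e3)
      (simp add: mult_ac)
  have s2: "(\<Sum>j\<in>UNIV. G x y $ j * dy j (dy k (coord G i)) x y)
      = P x y * (dy k P x y * y $ i + P x y * of_bool (i = k))"
  proof -
    have "(\<Sum>j\<in>UNIV. G x y $ j * dy j (dy k (coord G i)) x y)
      = (\<Sum>j\<in>UNIV. P x y * y $ i * (y $ j * dy j (dy k P) x y) + P x y * dy k P x y * y $ j * of_bool (i = j)
          + P x y * of_bool (i = k) * (y $ j * dy j P x y))"
      using G[OF xy] by (intro sum.cong) (auto simp: algebra_simps)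
    also have "\<dots> = P x y * dy k P x y * y $ i + P x y * of_bool (i = k) * P x y"
      by (simp only: sum.distrib sum_of_bool e1 e2 sum_distrib_left[symmetric] mult_zero_right add_0)
    finally show ?thesis by (simp add: algebra_simps)
  qed
  have s3: "(\<Sum>j\<in>UNIV. dy j (coord G i) x y * dy k (coord G j) x y)
      = 3 * P x y * dy k P x y * y $ i + (P x y)\<^sup>2 * of_bool (i = k)"
  proof -
    have "(\<Sum>j\<in>UNIV. dy j (coord G i) x y * dy k (coord G j) x y)
      = (\<Sum>j\<in>UNIV. y $ i * dy k P x y * (y $ j * dy j P x y) + y $ i * P x y * dy j P x y * of_bool (j = k)
          + P x y * dy k P x y * y $ j * of_bool (i = j)
          + (P x y)\<^sup>2 * of_bool (i = j) * of_bool (j = k))"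
      by (intro sum.cong) (auto simp: algebra_simps power2_eq_square)
    also have "\<dots> = y $ i * dy k P x y * P x y + y $ i * P x y * dy k P x y
          + P x y * dy k P x y * y $ i + (P x y)\<^sup>2 * of_bool (i = k)"
      by (simp only: sum.distrib sum_of_bool e1 sum_distrib_left[symmetric])
    finally show ?thesis by (simp add: algebra_simps)
  qed
  show ?thesis
    unfolding riemann_curv_def s1 s2 s3 by (simp add: algebra_simps power2_eq_square)
qed

lemma berwald_deriv_projective:
  assumes G: "\<And>x y. (x, y) \<in> C \<Longrightarrow> G x y = P x y *\<^sub>R y" and P: "smooth P"
    and \<tau>: "smooth (coord \<tau> i)" "homogeneous 1 (coord \<tau> i)" and xy: "(x, y) \<in> C"
  shows "berwald_deriv G \<tau> i k x y = dx k (coord \<tau> i) x y - P x y * dy k (coord \<tau> i) x y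
     - 2 * dy k P x y * \<tau> x y $ i - dy i P x y * \<tau> x y $ k
     - (\<Sum>r\<in>UNIV. y $ r * \<tau> x y $ r) * dy k (dy i P) x y"
proof -
  note [simp] = coord_projective[OF G P xy]
  have s1: "(\<Sum>r\<in>UNIV. dy k (coord G r) x y * dy r (coord \<tau> i) x y)
     = dy k P x y * \<tau> x y $ i + P x y * dy k (coord \<tau> i) x y"
  proof -
    have "(\<Sum>r\<in>UNIV. dy k (coord G r) x y * dy r (coord \<tau> i) x y)
      = (\<Sum>r\<in>UNIV. dy k P x y * (y $ r * dy r (coord \<tau> i) x y) + P x y * dy r (coord \<tau> i) x y * of_bool (r = k))"
      by (intro sum.cong) (auto simp: algebra_simps)
    moreover have "(\<Sum>r\<in>UNIV. y $ r * dy r (coord \<tau> i) x y) = \<tau> x y $ i"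
      using euler[OF \<tau> xy] by (simp add: coord_def)
    ultimately show ?thesis
      by (simp add: sum.distrib sum_of_bool sum_distrib_left[symmetric])
  qed
  have s2: "(\<Sum>r\<in>UNIV. \<tau> x y $ r * dy k (dy i (coord G r)) x y)
     = (\<Sum>r\<in>UNIV. y $ r * \<tau> x y $ r) * dy k (dy i P) x y + dy i P x y * \<tau> x y $ k + dy k P x y * \<tau> x y $ i"
  proof -
    have "(\<Sum>r\<in>UNIV. \<tau> x y $ r * dy k (dy i (coord G r)) x y)
      = (\<Sum>r\<in>UNIV. y $ r * \<tau> x y $ r * dy k (dy i P) x y + dy i P x y * \<tau> x y $ r * of_bool (r = k)
          + dy k P x y * \<tau> x y $ r * of_bool (r = i))"
      by (intro sum.cong) (auto simp: algebra_simps)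
    then show ?thesis by (simp add: sum.distrib sum_of_bool sum_distrib_right)
  qed
  show ?thesis
    unfolding berwald_deriv_def hor_deriv_def s1 s2 by simp
qed

text \<open>
  The integrability condition of $L_{x^k} = 2 P_{y^k} L + P L_{y^k}$. One computes
  $y^j L_{x^j x^k}$ twice, once by differentiating $y^j L_{x^j} = 4 P L$ in $x^k$ and once by
  differentiating the equation itself along $y^j \partial_j$. For the curvature
  $R = P^2 - y^j P_{x^j}$ and $\tau_k = P P_{y^k} - P_{x^k}$ it says $R L_{y^k} = 2 \tau_k L$.
\<close>

lemma horizontally_constant_curvature:
  assumes hc: "horizontally_constant P L" and L: "smooth L" "homogeneous 2 L"
    and P: "smooth P" "homogeneous 1 P" "hamel P" and xy: "(x, y) \<in> C"
  shows "((P x y)\<^sup>2 - spray_deriv P x y) * dy k L x y = 2 * (P x y * dy k P x y - dx k P x y) * L x y"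
proof -
  have hcD: "dx k L x y = 2 * dy k P x y * L x y + P x y * dy k L x y" if "(x, y) \<in> C" for x y k
    using hc that unfolding horizontally_constant_def by fast
  have L0: "spray_deriv L x y = 4 * P x y * L x y" if "(x, y) \<in> C" for x y
    using spray_deriv_horizontally_constant[OF hc P(2,1) L(2,1) that] .
  have "dx k (\<lambda>x y. \<Sum>j\<in>UNIV. y $ j * dx j L x y) x y = dx k (\<lambda>x y. 4 * P x y * L x y) x y"
    using L0 by (intro dx_cong[OF xy]) (simp add: spray_deriv_def)
  then have A: "(\<Sum>j\<in>UNIV. y $ j * dx k (dx j L) x y) = 4 * dx k P x y * L x y + 4 * P x y * dx k L x y"
    using L P xy by simp
  have "dx j (dx k L) x y = dx j (\<lambda>x y. 2 * dy k P x y * L x y + P x y * dy k L x y) x y" for j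
    using hcD by (intro dx_cong[OF xy])
  then have B: "dx k (dx j L) x y = 2 * dx j (dy k P) x y * L x y + 2 * dy k P x y * dx j L x y
      + dx j P x y * dy k L x y + P x y * dy k (dx j L) x y" for j
    using L P xy by (simp add: dx_dx_commute[of L x y k j] dx_dy_commute[of L x y j k])
  have "(\<Sum>j\<in>UNIV. y $ j * dx k (dx j L) x y) = (\<Sum>j\<in>UNIV. 2 * L x y * (y $ j * dx j (dy k P) x y)
      + 2 * dy k P x y * (y $ j * dx j L x y) + dy k L x y * (y $ j * dx j P x y)
      + P x y * (y $ j * dy k (dx j L) x y))"
    unfolding B by (intro sum.cong) (auto simp: algebra_simps)
  also have "\<dots> = 2 * L x y * (\<Sum>j\<in>UNIV. y $ j * dx j (dy k P) x y) + 2 * dy k P x y * spray_deriv L x y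
      + dy k L x y * spray_deriv P x y + P x y * (\<Sum>j\<in>UNIV. y $ j * dy k (dx j L) x y)"
    by (simp add: sum.distrib sum_distrib_left[symmetric] spray_deriv_def)
  also have "(\<Sum>j\<in>UNIV. y $ j * dx j (dy k P) x y) = dx k P x y"
    using P(3) xy unfolding hamel_def by fast
  also have "(\<Sum>j\<in>UNIV. y $ j * dy k (dx j L) x y) = 4 * dy k P x y * L x y + 4 * P x y * dy k L x y - dx k L x y"
  proof -
    have "dy k (spray_deriv L) x y = dy k (\<lambda>x y. 4 * P x y * L x y) x y"
      using L0 by (intro dy_cong[OF xy])
    then show ?thesis unfolding dy_spray_deriv[OF L(1) xy] using L P xy by simp
  qed
  finally show ?thesis
    unfolding A L0[OF xy] hcD[OF xy] by (simp add: algebra_simps power2_eq_square)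
qed

end

section \<open>Convexity and vertical Hessians\<close>

lemma second_derivative_nonneg_at_min:
  fixes f :: "real \<Rightarrow> real"
  assumes f: "\<forall>\<^sub>F t in nhds 0. (f has_real_derivative f' t) (at t)"
    and f': "(f' has_real_derivative D) (at 0)"
    and min: "\<forall>\<^sub>F t in nhds 0. f 0 \<le> f t"
  shows "D \<ge> 0"
proof (rule ccontr)
  assume "\<not> D \<ge> 0"
  obtain d where d: "d > 0" "\<And>t. \<bar>t\<bar> < d \<Longrightarrow> (f has_real_derivative f' t) (at t)"
    "\<And>t. \<bar>t\<bar> < d \<Longrightarrow> f 0 \<le> f t"
    using eventually_conj[OF f min] unfolding eventually_nhds_metric by (auto simp: dist_real_def)
  have "f' 0 = 0"
    using d by (intro DERIV_local_min[OF d(2)]) auto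
  moreover obtain e where e: "e > 0" "\<And>h. 0 < h \<Longrightarrow> h < e \<Longrightarrow> f' 0 > f' (0 + h)"
    using DERIV_neg_dec_right[OF f'] \<open>\<not> D \<ge> 0\<close> by auto
  define h where "h = min d e / 2"
  have h: "0 < h" "h < d" "h < e" using d e by (auto simp: h_def)
  obtain z where z: "0 < z" "z < h" "f h - f 0 = (h - 0) * f' z"
    using MVT2[OF h(1), of f f'] d(2) h by auto
  ultimately have "f h - f 0 < 0"
    using e(2)[of z] h by (auto simp: mult_pos_neg)
  with d(3)[of h] h show False by auto
qed

lemma (in phase_region) pd_pd_vertical:
  assumes f: "smooth f" and xy: "(x, y) \<in> C"
  shows "pd (0, v) (\<lambda>x y. pd (0, v) f x y) x y = (\<Sum>i\<in>UNIV. \<Sum>j\<in>UNIV. v $ i * v $ j * dy j (dy i f) x y)"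
proof -
  have dj: "dy j (\<lambda>x y. pd (0, v) f x y) x y = (\<Sum>i\<in>UNIV. v $ i * dy j (dy i f) x y)" for j
  proof -
    have "dy j (\<lambda>x y. pd (0, v) f x y) x y = dy j (\<lambda>x y. \<Sum>i\<in>UNIV. v $ i * dy i f x y) x y"
      using pd_vertical[OF f] by (intro dy_cong[OF xy])
    then show ?thesis using f xy by simp
  qed
  have "pd (0, v) (\<lambda>x y. pd (0, v) f x y) x y = (\<Sum>j\<in>UNIV. v $ j * (\<Sum>i\<in>UNIV. v $ i * dy j (dy i f) x y))"
    unfolding pd_vertical[OF smooth_pd[OF f] xy] dj ..
  also have "\<dots> = (\<Sum>i\<in>UNIV. \<Sum>j\<in>UNIV. v $ i * v $ j * dy j (dy i f) x y)"
    unfolding sum_distrib_left by (subst sum.swap) (simp add: mult_ac)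
  finally show ?thesis .
qed

text \<open>
  A subadditive function of degree one satisfies $2 f(y) = f(2y) \le f(y + tv) + f(y - tv)$, so
  the right-hand side has a minimum at $t = 0$, and its second derivative there is twice the
  Hessian at $v$.
\<close>

lemma (in conical_phase_region) vertical_hessian_nonneg:
  assumes f: "smooth f" "homogeneous 1 f" and xy: "(x, y) \<in> C"
    and sub: "\<And>y z. (x, y) \<in> C \<Longrightarrow> (x, z) \<in> C \<Longrightarrow> (x, y + z) \<in> C \<Longrightarrow> f x (y + z) \<le> f x y + f x z"
  shows "0 \<le> (\<Sum>i\<in>UNIV. \<Sum>j\<in>UNIV. v $ i * v $ j * dy j (dy i f) x y)"
proof -
  let ?D = "\<lambda>v t. pd (0, v) f x (y + t *\<^sub>R v)"
  let ?DD = "\<lambda>v. pd (0, v) (\<lambda>x y. pd (0, v) f x y) x y"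
  have near: "\<forall>\<^sub>F t in nhds 0. (x, y + t *\<^sub>R v) \<in> C" for v
    using eventually_in_region[OF xy, of 0 v] by simp
  have D: "((\<lambda>t. f x (y + t *\<^sub>R v)) has_real_derivative ?D v t) (at t)" if "(x, y + t *\<^sub>R v) \<in> C" for t v
    using pd_along[OF f(1), of x t 0 y v] that by simp
  have DD: "(?D v has_real_derivative ?DD v) (at 0)" for v
    using pd_along[OF smooth_pd[OF f(1), of "(0, v)"], of x 0 0 y v] xy by simp
  have "0 \<le> ?DD v + ?DD (- v)"
  proof (rule second_derivative_nonneg_at_min)
    show "\<forall>\<^sub>F t in nhds 0. ((\<lambda>t. f x (y + t *\<^sub>R v) + f x (y + t *\<^sub>R (- v))) has_real_derivative
        ?D v t + ?D (- v) t) (at t)"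
      using near[of v] near[of "- v"]
    proof eventually_elim
      case (elim t)
      show ?case using D[OF elim(1)] D[OF elim(2)] by (rule DERIV_add)
    qed
    show "((\<lambda>t. ?D v t + ?D (- v) t) has_real_derivative ?DD v + ?DD (- v)) (at 0)"
      by (intro DERIV_add DD)
    show "\<forall>\<^sub>F t in nhds 0. f x (y + 0 *\<^sub>R v) + f x (y + 0 *\<^sub>R (- v)) \<le> f x (y + t *\<^sub>R v) + f x (y + t *\<^sub>R (- v))"
      using near[of v] near[of "- v"]
    proof eventually_elim
      case (elim t)
      have "y + t *\<^sub>R v + (y + t *\<^sub>R (- v)) = 2 *\<^sub>R y" by (simp add: scaleR_2)
      moreover have "f x (2 *\<^sub>R y) = 2 * f x y"
        using f(2) xy unfolding pos_homogeneous_def by force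
      ultimately show ?case using sub[OF elim] cone[OF xy, of 2] by simp
    qed
  qed
  then show ?thesis by (simp add: pd_pd_vertical[OF f(1) xy])
qed

lemma invertible_iff_kernel:
  fixes A :: "real ^ 'n ^ 'n::finite"
  shows "invertible A \<longleftrightarrow> (\<forall>v. A *v v = 0 \<longrightarrow> v = 0)"
  by (simp add: invertible_left_inverse matrix_left_invertible_ker)

text \<open>
  If \<open>w = H v\<close> were nonzero, moving \<open>v\<close> slightly against \<open>w\<close> would make the form negative.
\<close>

lemma psd_form_zero_imp_kernel:
  fixes H :: "real ^ 'n ^ 'n::finite"
  assumes sym: "transpose H = H" and psd: "\<And>v. 0 \<le> v \<bullet> (H *v v)" and zero: "v \<bullet> (H *v v) = 0"
  shows "H *v v = 0"
proof (rule ccontr)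
  assume ne: "H *v v \<noteq> 0"
  define w where "w = H *v v"
  define q where "q = w \<bullet> w"
  define p where "p = w \<bullet> (H *v w)"
  have q: "q > 0" and p: "p \<ge> 0" using ne psd by (auto simp: q_def p_def w_def)
  have vw: "v \<bullet> (H *v w) = q"
    using dot_lmul_matrix[of v H w] sym by (simp add: q_def w_def flip: transpose_matrix_vector)
  have quad: "(v + t *\<^sub>R w) \<bullet> (H *v (v + t *\<^sub>R w)) = 2 * t * q + t\<^sup>2 * p" for t
    using zero vw
    by (simp add: matrix_vector_right_distrib linear_cmul[OF matrix_vector_mul_linear] inner_add_left inner_add_right
        power2_eq_square distrib_left mult_ac flip: w_def p_def q_def)
  \<comment> \<open>Any \<open>t\<close> strictly between \<open>- 2 * q / p\<close> and \<open>0\<close> makes \<open>2 * t * q + t\<^sup>2 * p\<close> negative;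
    adding one avoids the case \<open>p = 0\<close>.\<close>
  define t where "t = - q / (p + 1)"
  have t: "q = - t * (p + 1)" "t \<noteq> 0" using p q by (auto simp: t_def)
  have "0 \<le> 2 * t * q + t\<^sup>2 * p"
    using psd[of "v + t *\<^sub>R w"] unfolding quad .
  also have "\<dots> = - (t\<^sup>2 * (p + 2))"
    unfolding t(1) by (simp add: algebra_simps power2_eq_square)
  also have "\<dots> < 0" using p t(2) by simp
  finally show False by simp
qed


section \<open>The Funk metric\<close>

locale funk_domain =
  fixes \<Omega> :: "(real ^ 'n::finite) set" and F :: "'n phase_fun"
  assumes card: "CARD('n) \<ge> 2"
    and domain: "open \<Omega>" "\<Omega> \<noteq> {}" "convex \<Omega>"
    and funk: "funk_metric \<Omega> F"
    and finsler: "pos_finsler_metric \<Omega> (slit_tangent \<Omega>) F"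
begin

sublocale conical_phase_region "slit_tangent \<Omega>"
proof
  show "open (slit_tangent \<Omega>)"
    unfolding slit_tangent_def by (intro open_Times domain(1) open_Compl closed_singleton)
qed (auto simp: slit_tangent_def)

lemma in_region_iff [simp]: "(x, y) \<in> slit_tangent \<Omega> \<longleftrightarrow> x \<in> \<Omega> \<and> y \<noteq> 0"
  by (auto simp: slit_tangent_def)

lemma funk_pos: "x \<in> \<Omega> \<Longrightarrow> y \<noteq> 0 \<Longrightarrow> F x y > 0"
  using funk by (simp add: funk_metric_def)

lemma funk_boundary: "x \<in> \<Omega> \<Longrightarrow> y \<noteq> 0 \<Longrightarrow> x + (1 / F x y) *\<^sub>R y \<in> frontier \<Omega>"
  using funk by (simp add: funk_metric_def)

text \<open>
  An open segment from an interior point of a convex set to a point of its closure is interior.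
  Hence a ray from \<open>x\<close> meets the frontier once, and the Funk metric is determined by the
  boundary point.
\<close>

lemma ray_interior:
  assumes x: "x \<in> \<Omega>" and y: "y \<noteq> 0" and st: "0 < s" "s < t" and c: "x + t *\<^sub>R y \<in> closure \<Omega>"
  shows "x + s *\<^sub>R y \<notin> frontier \<Omega>"
proof -
  have "x + s *\<^sub>R y = (1 - s / t) *\<^sub>R x + (s / t) *\<^sub>R (x + t *\<^sub>R y)"
    using st by (simp add: algebra_simps)
  moreover have "0 < s / t" "s / t < 1" "x \<noteq> x + t *\<^sub>R y" using st y by auto
  ultimately have "x + s *\<^sub>R y \<in> open_segment x (x + t *\<^sub>R y)"
    unfolding in_segment by blast
  then have "x + s *\<^sub>R y \<in> interior \<Omega>"
    using in_interior_closure_convex_segment[OF domain(3) _ c] x domain(1) by (auto simp: interior_open)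
  then show ?thesis by (simp add: frontier_def)
qed

lemma frontier_closure: "z \<in> frontier \<Omega> \<Longrightarrow> z \<in> closure \<Omega>"
  by (simp add: frontier_def)

lemma funk_unique:
  assumes x: "x \<in> \<Omega>" and y: "y \<noteq> 0" and m: "m > 0" "x + (1 / m) *\<^sub>R y \<in> frontier \<Omega>"
  shows "F x y = m"
proof (rule ccontr)
  assume "F x y \<noteq> m"
  then consider "1 / F x y < 1 / m" | "1 / m < 1 / F x y"
    using funk_pos[OF x y] m(1) by (auto simp: field_simps neq_iff)
  then show False
    using ray_interior[OF x y _ _ frontier_closure[OF m(2)]] funk_boundary[OF x y]
      ray_interior[OF x y _ _ frontier_closure[OF funk_boundary[OF x y]]] m funk_pos[OF x y]
    by cases auto
qed

lemma funk_scale: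
  assumes "x \<in> \<Omega>" "y \<noteq> 0" "s > 0"
  shows "F x (s *\<^sub>R y) = s * F x y"
  using assms funk_pos[OF assms(1,2)] funk_boundary[OF assms(1,2)] by (intro funk_unique) auto

lemma funk_homogeneous: "homogeneous 1 F"
  using funk_scale by (auto simp: pos_homogeneous_def)

text \<open>
  The boundary points in directions \<open>y\<close> and \<open>z\<close> have a convex combination on the ray in
  direction \<open>y + z\<close>, at parameter $1/(F(y) + F(z))$; this ray cannot have left the domain before.
\<close>

lemma funk_subadditive:
  assumes x: "x \<in> \<Omega>" and y: "y \<noteq> 0" and z: "z \<noteq> 0" and yz: "y + z \<noteq> 0"
  shows "F x (y + z) \<le> F x y + F x z"
proof (rule ccontr)
  assume gt: "\<not> F x (y + z) \<le> F x y + F x z"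
  define p q where "p = F x y" and "q = F x z"
  have pq: "p > 0" "q > 0" using funk_pos x y z by (auto simp: p_def q_def)
  have one: "p / (p + q) + q / (p + q) = 1"
    using pq by (simp flip: add_divide_distrib)
  have "(p / (p + q)) *\<^sub>R (x + (1 / p) *\<^sub>R y) + (q / (p + q)) *\<^sub>R (x + (1 / q) *\<^sub>R z) \<in> closure \<Omega>"
    using pq frontier_closure[OF funk_boundary[OF x y]] frontier_closure[OF funk_boundary[OF x z]]
    by (intro convexD[OF convex_closure[OF domain(3)]] one) (auto simp: p_def q_def)
  also have "(p / (p + q)) *\<^sub>R (x + (1 / p) *\<^sub>R y) + (q / (p + q)) *\<^sub>R (x + (1 / q) *\<^sub>R z)
      = (p / (p + q) + q / (p + q)) *\<^sub>R x + (1 / (p + q)) *\<^sub>R (y + z)"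
    using pq by (simp add: scaleR_add_left scaleR_add_right)
  finally have "x + (1 / (p + q)) *\<^sub>R (y + z) \<in> closure \<Omega>" by (simp add: one)
  moreover have "1 / F x (y + z) < 1 / (p + q)" "0 < 1 / F x (y + z)"
    using gt pq funk_pos[OF x yz] by (auto simp: p_def q_def field_simps)
  ultimately show False
    using ray_interior[OF x yz] funk_boundary[OF x yz] by blast
qed

lemma funk_smooth [simp]: "smooth F"
proof -
  have "smooth (\<lambda>x y. (F x y)\<^sup>2)"
    using finsler by (simp add: pos_finsler_metric_def finsler_metric_def)
  then have "smooth (\<lambda>x y. sqrt ((F x y)\<^sup>2))"
    by (rule smooth_sqrt) (metis in_region_iff funk_pos zero_less_power)
  then show ?thesis
    using smooth_cong[of "\<lambda>x y. sqrt ((F x y)\<^sup>2)" F] funk_pos by (auto simp: less_imp_le)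
qed

text \<open>
  Okada's identity. Moving the base point by \<open>t *\<^sub>R w\<close> and the direction by \<open>- t * F x y\<close> times \<open>w\<close>
  keeps the boundary point \<open>x + (1 / F x y) *\<^sub>R y\<close> fixed and so keeps the value of \<open>F\<close>. The
  derivative of \<open>F\<close> along this line of phase space is therefore zero.
\<close>

lemma dx_funk:
  assumes "x \<in> \<Omega>" "y \<noteq> 0"
  shows "dx k F x y = F x y * dy k F x y"
proof -
  let ?w = "axis k 1 :: real ^ 'n"
  have xy: "(x, y) \<in> slit_tangent \<Omega>" using assms by simp
  have "\<forall>\<^sub>F t in nhds 0. F (x + t *\<^sub>R ?w) (y + t *\<^sub>R (- F x y *\<^sub>R ?w)) = F x y"
    using eventually_in_region[OF xy, of ?w "- F x y *\<^sub>R ?w"]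
  proof (rule eventually_mono)
    fix t assume t: "(x + t *\<^sub>R ?w, y + t *\<^sub>R (- F x y *\<^sub>R ?w)) \<in> slit_tangent \<Omega>"
    have eq: "x + t *\<^sub>R ?w + (1 / F x y) *\<^sub>R (y + t *\<^sub>R (- F x y *\<^sub>R ?w)) = x + (1 / F x y) *\<^sub>R y"
      using funk_pos[OF assms] by (simp add: algebra_simps)
    show "F (x + t *\<^sub>R ?w) (y + t *\<^sub>R (- F x y *\<^sub>R ?w)) = F x y"
    proof (rule funk_unique)
      show "x + t *\<^sub>R ?w + (1 / F x y) *\<^sub>R (y + t *\<^sub>R (- F x y *\<^sub>R ?w)) \<in> frontier \<Omega>"
        unfolding eq by (rule funk_boundary[OF assms])
    qed (use t funk_pos[OF assms] in \<open>auto simp only: in_region_iff\<close>)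
  qed
  then have "((\<lambda>t. F (x + t *\<^sub>R ?w) (y + t *\<^sub>R (- F x y *\<^sub>R ?w))) has_real_derivative 0) (at 0)"
    by (subst DERIV_cong_ev[OF refl _ refl, of _ "\<lambda>t. F x y"]) auto
  moreover have "((\<lambda>t. F (x + t *\<^sub>R ?w) (y + t *\<^sub>R (- F x y *\<^sub>R ?w))) has_real_derivative
      pd (?w, - F x y *\<^sub>R ?w) F x y) (at 0)"
    using pd_along[OF funk_smooth, of x 0 ?w y "- F x y *\<^sub>R ?w"] xy by simp
  ultimately have "pd (?w, - F x y *\<^sub>R ?w) F x y = 0" by (rule DERIV_unique[symmetric])
  moreover have "pd (?w, - F x y *\<^sub>R ?w) F x y = dx k F x y - F x y * dy k F x y"
    using pd_add_direction[OF funk_smooth xy, of "(?w, 0)" "(- F x y) *\<^sub>R (0, ?w)"]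
      pd_scale_direction[OF funk_smooth xy, of "- F x y" "(0, ?w)"]
      dx_eq_pd[OF funk_smooth xy] dy_eq_pd[OF funk_smooth xy] by simp
  ultimately show ?thesis by simp
qed

definition Frev :: "'n phase_fun" where
  "Frev x y = F x (- y)"

lemma Frev_pos: "x \<in> \<Omega> \<Longrightarrow> y \<noteq> 0 \<Longrightarrow> Frev x y > 0"
  by (simp add: Frev_def funk_pos)

lemma Frev_homogeneous: "homogeneous 1 Frev"
  using funk_scale[of _ "- _"] by (auto simp: pos_homogeneous_def Frev_def)

lemma Frev_smooth [simp]: "smooth Frev"
proof -
  have "Ck_on k (\<lambda>z. F (fst (fst z, - snd z)) (snd (fst z, - snd z))) (slit_tangent \<Omega>)" for k
    using funk_smooth unfolding smooth_iff
    by (intro Ck_on_compose_linear[OF open_region open_region, of "\<lambda>z. (fst z, - snd z)"])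
      (auto simp: slit_tangent_def intro!: bounded_linear_Pair bounded_linear_fst bounded_linear_snd bounded_linear_minus)
  then show ?thesis by (simp add: smooth_iff Frev_def)
qed

lemma dx_Frev:
  assumes "x \<in> \<Omega>" "y \<noteq> 0"
  shows "dx k Frev x y = - (Frev x y * dy k Frev x y)"
proof -
  have xy: "(x, - y) \<in> slit_tangent \<Omega>" using assms by simp
  have "dx k Frev x y = dx k F x (- y)" by (simp add: dx_def Frev_def)
  moreover have "dy k Frev x y = - dy k F x (- y)"
  proof (rule dy_eqI)
    have "pd (0, - axis k 1) F x (- y) = - dy k F x (- y)"
      using pd_scale_direction[OF funk_smooth xy, of "- 1" "(0, axis k 1)"] dy_eq_pd[OF funk_smooth xy] by simp
    then show "((\<lambda>t. Frev x (y + t *\<^sub>R axis k 1)) has_real_derivative - dy k F x (- y)) (at 0)"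
      using pd_along[OF funk_smooth, of x 0 0 "- y" "- axis k 1"] xy by (simp add: Frev_def)
  qed
  ultimately show ?thesis using dx_funk[of x "- y"] assms by (simp add: Frev_def)
qed

text \<open>
  With these rules every derivative in the curvature computations becomes a polynomial in \<open>F\<close>,
  \<open>Frev\<close> and their vertical derivatives of order at most two.
\<close>

lemma dx_dy_funk:
  assumes "x \<in> \<Omega>" "y \<noteq> 0"
  shows "dx j (dy k F) x y = dy k F x y * dy j F x y + F x y * dy j (dy k F) x y"
    and "dx j (dy k Frev) x y = - (dy k Frev x y * dy j Frev x y + Frev x y * dy j (dy k Frev) x y)"
proof -
  have xy: "(x, y) \<in> slit_tangent \<Omega>" using assms by simp
  have "dy k (dx j F) x y = dy k (\<lambda>x y. F x y * dy j F x y) x y"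
    "dy k (dx j Frev) x y = dy k (\<lambda>x y. - (Frev x y * dy j Frev x y)) x y"
    by (auto intro!: dy_cong[OF xy] simp: dx_funk dx_Frev)
  then show "dx j (dy k F) x y = dy k F x y * dy j F x y + F x y * dy j (dy k F) x y"
    "dx j (dy k Frev) x y = - (dy k Frev x y * dy j Frev x y + Frev x y * dy j (dy k Frev) x y)"
    using xy dy_dy_commute[OF funk_smooth xy, of j k] dy_dy_commute[OF Frev_smooth xy, of j k]
    by (simp_all add: dx_dy_commute)
qed

lemma funk_hessian_psd:
  assumes "x \<in> \<Omega>" "y \<noteq> 0"
  shows "0 \<le> (\<Sum>i\<in>UNIV. \<Sum>j\<in>UNIV. v $ i * v $ j * dy j (dy i F) x y)"
    and "0 \<le> (\<Sum>i\<in>UNIV. \<Sum>j\<in>UNIV. v $ i * v $ j * dy j (dy i Frev) x y)"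
proof -
  have "Frev x (y + z) \<le> Frev x y + Frev x z" if "y \<noteq> 0" "z \<noteq> 0" "y + z \<noteq> 0" for y z
    using funk_subadditive[of x "- y" "- z"] that assms(1)
    by (simp add: Frev_def) (metis add_eq_0_iff minus_diff_commute neg_eq_iff_add_eq_0)
  then show "0 \<le> (\<Sum>i\<in>UNIV. \<Sum>j\<in>UNIV. v $ i * v $ j * dy j (dy i F) x y)"
    "0 \<le> (\<Sum>i\<in>UNIV. \<Sum>j\<in>UNIV. v $ i * v $ j * dy j (dy i Frev) x y)"
    using assms funk_subadditive
    by (auto intro!: vertical_hessian_nonneg funk_homogeneous Frev_homogeneous)
qed

end

section \<open>Curvature of the deformed spray\<close>

locale deformed_funk = funk_domain \<Omega> F
  for \<Omega> :: "(real ^ 'n::finite) set" and F +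
  fixes c :: real
begin

text \<open>
  The deformed spray is $P y^i$. Its Riemann curvature is $R \delta^i_k - T_k y^i$, and
  $R_{;k} = - c (2 c + 1) Q_{y^k}$, so that \<open>Q\<close> carries the whole obstruction to constant curvature.
\<close>

definition P :: "'n phase_fun" where
  "P x y = 1/2 * F x y + c * Frev x y"

definition R :: "'n phase_fun" where
  "R x y = c * (F x y * Frev x y) + (c\<^sup>2 + c) * (Frev x y)\<^sup>2 - 1/4 * (F x y)\<^sup>2"

definition T :: "'n \<Rightarrow> 'n phase_fun" where
  "T k x y = c/2 * (F x y * dy k Frev x y + Frev x y * dy k F x y)
     + (c\<^sup>2 + c) * (Frev x y * dy k Frev x y) - 1/4 * (F x y * dy k F x y)"

definition Q :: "'n phase_fun" where
  "Q x y = F x y * (Frev x y)\<^sup>2 + 2/3 * (c + 1) * (Frev x y)^3"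

lemma smooth_PRTQ [simp]: "smooth P" "smooth R" "smooth (T k)" "smooth Q"
  by (simp_all add: P_def[abs_def] R_def[abs_def] T_def[abs_def] Q_def[abs_def])

lemma euler_funk:
  assumes "x \<in> \<Omega>" "y \<noteq> 0"
  shows "(\<Sum>k\<in>UNIV. y $ k * dy k F x y) = F x y"
    and "(\<Sum>k\<in>UNIV. y $ k * dy k Frev x y) = Frev x y"
    and "(\<Sum>j\<in>UNIV. y $ j * dy j (dy k F) x y) = 0"
    and "(\<Sum>j\<in>UNIV. y $ j * dy j (dy k Frev) x y) = 0"
  using euler[OF funk_smooth funk_homogeneous, of x y] euler[OF Frev_smooth Frev_homogeneous, of x y]
    euler_dy[OF funk_smooth, of 0 x y k] euler_dy[OF Frev_smooth, of 0 x y k]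
    funk_homogeneous Frev_homogeneous assms
  by simp_all

lemma homogeneous_funk_dy: "homogeneous 0 (dy k F)" "homogeneous 0 (dy k Frev)"
  using homogeneous_dy[of F 0] homogeneous_dy[of Frev 0] funk_homogeneous Frev_homogeneous by simp_all

lemma homogeneous_PRTQ: "homogeneous 1 P" "homogeneous 2 R" "homogeneous 1 (T k)" "homogeneous 3 Q"
proof -
  have "F x (s *\<^sub>R y) = s * F x y" "Frev x (s *\<^sub>R y) = s * Frev x y"
    "dy k F x (s *\<^sub>R y) = dy k F x y" "dy k Frev x (s *\<^sub>R y) = dy k Frev x y"
    if "x \<in> \<Omega>" "y \<noteq> 0" "s > 0" for x y s
    using that funk_homogeneous Frev_homogeneous homogeneous_funk_dy[of k]
    by (auto simp: pos_homogeneous_def slit_tangent_def)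
  then show "homogeneous 1 P" "homogeneous 2 R" "homogeneous 1 (T k)" "homogeneous 3 Q"
    by (simp_all add: pos_homogeneous_def slit_tangent_def P_def R_def T_def Q_def power2_eq_square
        power3_eq_cube algebra_simps)
qed

lemma P_derivs:
  assumes "x \<in> \<Omega>" "y \<noteq> 0"
  shows "dy k P x y = 1/2 * dy k F x y + c * dy k Frev x y"
    and "dx k P x y = 1/2 * (F x y * dy k F x y) - c * (Frev x y * dy k Frev x y)"
    and "dy j (dy k P) x y = 1/2 * dy j (dy k F) x y + c * dy j (dy k Frev) x y"
    and "dx j (dy k P) x y = 1/2 * (dy k F x y * dy j F x y + F x y * dy j (dy k F) x y)
      - c * (dy k Frev x y * dy j Frev x y + Frev x y * dy j (dy k Frev) x y)"
proof -
  have xy: "(x, y) \<in> slit_tangent \<Omega>" using assms by simp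
  have k: "dy k P x y = 1/2 * dy k F x y + c * dy k Frev x y" if "(x, y) \<in> slit_tangent \<Omega>" for x y
    using that by (simp add: P_def[abs_def])
  show "dy k P x y = 1/2 * dy k F x y + c * dy k Frev x y" using k[OF xy] .
  show "dx k P x y = 1/2 * (F x y * dy k F x y) - c * (Frev x y * dy k Frev x y)"
    using assms by (simp add: P_def[abs_def] dx_funk dx_Frev)
  show "dy j (dy k P) x y = 1/2 * dy j (dy k F) x y + c * dy j (dy k Frev) x y"
    using dy_cong[OF xy k] assms by simp
  show "dx j (dy k P) x y = 1/2 * (dy k F x y * dy j F x y + F x y * dy j (dy k F) x y)
      - c * (dy k Frev x y * dy j Frev x y + Frev x y * dy j (dy k Frev) x y)"
    using dx_cong[OF xy k] assms by (simp add: dx_dy_funk algebra_simps)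
qed

lemma spray_deriv_P:
  assumes "x \<in> \<Omega>" "y \<noteq> 0"
  shows "spray_deriv P x y = 1/2 * (F x y)\<^sup>2 - c * (Frev x y)\<^sup>2"
proof -
  have "spray_deriv P x y = (\<Sum>j\<in>UNIV. 1/2 * F x y * (y $ j * dy j F x y) - c * Frev x y * (y $ j * dy j Frev x y))"
    unfolding spray_deriv_def P_derivs[OF assms] by (intro sum.cong) (auto simp: algebra_simps)
  then show ?thesis
    by (simp only: sum_subtractf sum_distrib_left[symmetric] euler_funk[OF assms]) (simp add: power2_eq_square)
qed

lemma hamel_P: "hamel P"
  unfolding hamel_def
proof clarify
  fix x y k assume "(x, y) \<in> slit_tangent \<Omega>"
  then have xy: "x \<in> \<Omega>" "y \<noteq> 0" by auto
  have "(\<Sum>j\<in>UNIV. y $ j * dx j (dy k P) x y) = (\<Sum>j\<in>UNIV. 1/2 * dy k F x y * (y $ j * dy j F x y)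
      + 1/2 * F x y * (y $ j * dy j (dy k F) x y) - c * dy k Frev x y * (y $ j * dy j Frev x y)
      - c * Frev x y * (y $ j * dy j (dy k Frev) x y))"
    unfolding P_derivs[OF xy] by (intro sum.cong) (auto simp: algebra_simps)
  also have "\<dots> = dx k P x y"
    unfolding P_derivs[OF xy]
    by (simp only: sum.distrib sum_subtractf sum_distrib_left[symmetric] euler_funk[OF xy]) simp
  finally show "(\<Sum>j\<in>UNIV. y $ j * dx j (dy k P) x y) = dx k P x y" .
qed

lemma curvature_R:
  assumes "x \<in> \<Omega>" "y \<noteq> 0"
  shows "(P x y)\<^sup>2 - spray_deriv P x y = R x y"
    and "P x y * dy k P x y - dx k P x y = T k x y"
  unfolding spray_deriv_P[OF assms] P_derivs[OF assms]
  by (simp_all add: P_def R_def T_def power2_eq_square field_simps)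

lemma R_derivs:
  assumes "x \<in> \<Omega>" "y \<noteq> 0"
  shows "dy k R x y = 2 * T k x y"
    and "dx k R x y = 2 * dy k P x y * R x y + P x y * dy k R x y - c * (2 * c + 1) * dy k Q x y"
proof -
  show "dy k R x y = 2 * T k x y"
    using assms by (simp add: R_def[abs_def] T_def algebra_simps)
  show "dx k R x y = 2 * dy k P x y * R x y + P x y * dy k R x y - c * (2 * c + 1) * dy k Q x y"
    using assms unfolding P_derivs[OF assms]
    by (simp add: R_def[abs_def] Q_def[abs_def] P_def dx_funk dx_Frev)
      (simp add: power2_eq_square power3_eq_cube field_simps)
qed

lemma Q_derivs:
  assumes "x \<in> \<Omega>" "y \<noteq> 0"
  shows "dy k Q x y = (Frev x y)\<^sup>2 * dy k F x y
      + 2 * (F x y * Frev x y + (c + 1) * (Frev x y)\<^sup>2) * dy k Frev x y"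
    and "dy j (dy k Q) x y = (Frev x y)\<^sup>2 * dy j (dy k F) x y + 2 * Frev x y * dy j Frev x y * dy k F x y
      + 2 * (F x y * Frev x y + (c + 1) * (Frev x y)\<^sup>2) * dy j (dy k Frev) x y
      + 2 * (dy j F x y * Frev x y + F x y * dy j Frev x y + 2 * (c + 1) * Frev x y * dy j Frev x y) * dy k Frev x y"
proof -
  have xy: "(x, y) \<in> slit_tangent \<Omega>" using assms by simp
  have k: "dy k Q x y = (Frev x y)\<^sup>2 * dy k F x y
      + 2 * (F x y * Frev x y + (c + 1) * (Frev x y)\<^sup>2) * dy k Frev x y"
    if "(x, y) \<in> slit_tangent \<Omega>" for x y
    using that by (simp add: Q_def[abs_def] field_simps power2_eq_square)
  show "dy k Q x y = (Frev x y)\<^sup>2 * dy k F x y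
      + 2 * (F x y * Frev x y + (c + 1) * (Frev x y)\<^sup>2) * dy k Frev x y" using k[OF xy] .
  show "dy j (dy k Q) x y = (Frev x y)\<^sup>2 * dy j (dy k F) x y + 2 * Frev x y * dy j Frev x y * dy k F x y
      + 2 * (F x y * Frev x y + (c + 1) * (Frev x y)\<^sup>2) * dy j (dy k Frev) x y
      + 2 * (dy j F x y * Frev x y + F x y * dy j Frev x y + 2 * (c + 1) * Frev x y * dy j Frev x y) * dy k Frev x y"
    using dy_cong[OF xy k] assms by (simp add: algebra_simps)
qed

text \<open>
  Since $3 Q = F'^2 (3 F + 2 (c + 1) F')$ with \<open>F' = Frev\<close>, vanishing of \<open>Q\<close> means
  $3 F = - 2 (c + 1) F'$. Along $y^k \partial_k$ one has $F \mapsto F^2$ but $F' \mapsto - F'^2$,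
  so the derivative of this relation says $3 F^2 = 2 (c + 1) F'^2 = - 3 F F'$, which is impossible
  for positive functions.
\<close>

lemma Q_not_zero:
  assumes D: "open D" "D \<subseteq> slit_tangent \<Omega>" "D \<noteq> {}"
  shows "\<exists>(x, y)\<in>D. Q x y \<noteq> 0"
proof (rule ccontr)
  assume "\<not> ?thesis"
  then have Q0: "Q x y = 0" if "(x, y) \<in> D" for x y using that by blast
  interpret D: phase_region D by unfold_locales (rule D)
  have lin: "3 * F x y + 2 * (c + 1) * Frev x y = 0" if "(x, y) \<in> D" for x y
  proof -
    have "Frev x y > 0" using that D Frev_pos by auto
    moreover have "3 * Q x y = (Frev x y)\<^sup>2 * (3 * F x y + 2 * (c + 1) * Frev x y)"
      by (simp add: Q_def field_simps power2_eq_square power3_eq_cube)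
    ultimately show ?thesis using Q0[OF that] by simp
  qed
  obtain x y where xyD: "(x, y) \<in> D" using D(3) by auto
  then have xy: "x \<in> \<Omega>" "y \<noteq> 0" using D(2) by auto
  have sm: "smooth_phase D F" "smooth_phase D Frev" using smooth_subset D(2) by auto
  have "dx k (\<lambda>x y. 3 * F x y + 2 * (c + 1) * Frev x y) x y = 0" for k
    using D.dx_cong[OF xyD, of "\<lambda>x y. 3 * F x y + 2 * (c + 1) * Frev x y" "\<lambda>x y. 0" k] lin
    by simp
  then have "3 * (F x y * dy k F x y) - 2 * (c + 1) * (Frev x y * dy k Frev x y) = 0" for k
    using sm xyD xy by (simp add: dx_funk dx_Frev)
  then have "(\<Sum>k\<in>UNIV. y $ k * (3 * (F x y * dy k F x y) - 2 * (c + 1) * (Frev x y * dy k Frev x y))) = 0"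
    by simp
  also have "(\<Sum>k\<in>UNIV. y $ k * (3 * (F x y * dy k F x y) - 2 * (c + 1) * (Frev x y * dy k Frev x y)))
     = (\<Sum>k\<in>UNIV. 3 * F x y * (y $ k * dy k F x y) - 2 * (c + 1) * Frev x y * (y $ k * dy k Frev x y))"
    by (intro sum.cong) (auto simp: algebra_simps)
  also have "\<dots> = 3 * F x y * F x y - 2 * (c + 1) * Frev x y * Frev x y"
    by (simp only: sum_subtractf sum_distrib_left[symmetric] euler_funk[OF xy])
  also have "\<dots> = 3 * F x y * (F x y + Frev x y)"
  proof -
    have "2 * (c + 1) * Frev x y = - 3 * F x y" using lin[OF xyD] by linarith
    from arg_cong[OF this, of "\<lambda>z. z * Frev x y"] show ?thesis by (simp add: algebra_simps)
  qed
  finally show False using funk_pos[OF xy] Frev_pos[OF xy] by simp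
qed

lemma finsler_spray_funk:
  assumes "x \<in> \<Omega>" "y \<noteq> 0"
  shows "finsler_spray (\<lambda>x y. (F x y)\<^sup>2) x y = (1/2 * F x y) *\<^sub>R y"
proof -
  have "horizontally_constant (\<lambda>x y. 1/2 * F x y) (\<lambda>x y. (F x y)\<^sup>2)"
    by (auto simp: horizontally_constant_def dx_funk power2_eq_square)
  moreover have "homogeneous 2 (\<lambda>x y. (F x y)\<^sup>2)" "homogeneous 1 (\<lambda>x y. 1/2 * F x y)"
    using funk_homogeneous by (auto simp: pos_homogeneous_def power2_eq_square)
  moreover have "invertible (fund_tensor (\<lambda>x y. (F x y)\<^sup>2) x y)" if "(x, y) \<in> slit_tangent \<Omega>" for x y
    using finsler that unfolding pos_finsler_metric_def finsler_metric_def by blast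
  ultimately have "\<forall>(x, y)\<in>slit_tangent \<Omega>. finsler_spray (\<lambda>x y. (F x y)\<^sup>2) x y = (1/2 * F x y) *\<^sub>R y"
    by (subst finsler_spray_projective) simp_all
  with assms show ?thesis by fastforce
qed

lemma deformed_spray_eq:
  "(x, y) \<in> slit_tangent \<Omega> \<Longrightarrow> deformed_spray F c x y = P x y *\<^sub>R y"
  by (simp add: deformed_spray_def finsler_spray_funk P_def Frev_def scaleR_add_left)


abbreviation G :: "'n phase_field" where
  "G \<equiv> deformed_spray F c"

definition tau :: "'n phase_field" where
  "tau x y = (\<chi> k. T k x y)"

lemma coord_tau [simp]: "coord tau k = T k"
  by (simp add: coord_def tau_def)

lemma tau_nth [simp]: "tau x y $ k = T k x y"
  by (simp add: tau_def)

lemma spray_G: "spray \<Omega> (slit_tangent \<Omega>) G"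
proof -
  have G: "coord G i x y = P x y * y $ i" if "(x, y) \<in> slit_tangent \<Omega>" for x y i
    by (rule coord_projective[OF deformed_spray_eq smooth_PRTQ(1) that])
  have "smooth (coord G i)" for i
    using smooth_cong[of "coord G i" "\<lambda>x y. P x y * y $ i"] G by simp
  moreover have "homogeneous 2 (coord G i)" for i
    using homogeneous_PRTQ(1) G by (auto simp: pos_homogeneous_def power2_eq_square)
  moreover have "conical_region \<Omega> (slit_tangent \<Omega>)"
    using finsler by (simp add: pos_finsler_metric_def finsler_metric_def)
  ultimately show ?thesis by (simp add: spray_def)
qed

lemma scalar_curvature_G: "scalar_curvature_with (slit_tangent \<Omega>) G R tau"
proof -
  have "riemann_curv G i k x y = R x y * of_bool (i = k) - T k x y * y $ i"
    if "x \<in> \<Omega>" "y \<noteq> 0" for x y i k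
    using riemann_curv_projective[OF deformed_spray_eq smooth_PRTQ(1) homogeneous_PRTQ(1) hamel_P, of x y i k]
      curvature_R[OF that] that by simp
  then show ?thesis
    using homogeneous_PRTQ by (auto simp: scalar_curvature_with_def)
qed

lemma isotropic_curvature_G: "isotropic_curvature (slit_tangent \<Omega>) G"
  unfolding isotropic_curvature_def
  using scalar_curvature_G R_derivs(1) by (intro exI[of _ R] exI[of _ tau]) auto

lemma tau_position:
  assumes "x \<in> \<Omega>" "y \<noteq> 0"
  shows "(\<Sum>k\<in>UNIV. y $ k * T k x y) = R x y"
proof -
  have "(\<Sum>k\<in>UNIV. 2 * (y $ k * T k x y)) = 2 * R x y"
    using euler[OF smooth_PRTQ(2) homogeneous_PRTQ(2), of x y] R_derivs(1)[OF assms] assms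
    by (simp add: mult.left_commute)
  then show ?thesis by (simp only: sum_distrib_left[symmetric])
qed

lemma T_derivs:
  assumes "x \<in> \<Omega>" "y \<noteq> 0"
  shows "dy k (T i) x y = c/2 * (dy k F x y * dy i Frev x y + F x y * dy k (dy i Frev) x y
        + dy k Frev x y * dy i F x y + Frev x y * dy k (dy i F) x y)
      + (c\<^sup>2 + c) * (dy k Frev x y * dy i Frev x y + Frev x y * dy k (dy i Frev) x y)
      - 1/4 * (dy k F x y * dy i F x y + F x y * dy k (dy i F) x y)"
    and "dx k (T i) x y = c/2 * (F x y * dy k F x y * dy i Frev x y
        - F x y * (dy i Frev x y * dy k Frev x y + Frev x y * dy k (dy i Frev) x y)
        - Frev x y * dy k Frev x y * dy i F x y
        + Frev x y * (dy i F x y * dy k F x y + F x y * dy k (dy i F) x y))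
      + (c\<^sup>2 + c) * (- Frev x y * dy k Frev x y * dy i Frev x y
        - Frev x y * (dy i Frev x y * dy k Frev x y + Frev x y * dy k (dy i Frev) x y))
      - 1/4 * (F x y * dy k F x y * dy i F x y
        + F x y * (dy i F x y * dy k F x y + F x y * dy k (dy i F) x y))"
  using assms by (simp_all add: T_def[abs_def] dx_funk dx_Frev dx_dy_funk) (simp add: field_simps)

text \<open>
  Vertical differentiation of $R_{;i} = - c (2 c + 1) Q_{y^i}$ gives
  $2 \tau_{i;k} = - c (2 c + 1) Q_{y^i y^k}$, since $2 \tau_i = R_{y^i}$.
\<close>

lemma berwald_deriv_tau:
  assumes "x \<in> \<Omega>" "y \<noteq> 0"
  shows "berwald_deriv G tau i k x y = - (c * (2 * c + 1) / 2) * dy k (dy i Q) x y"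
proof -
  have "berwald_deriv G tau i k x y = dx k (T i) x y - P x y * dy k (T i) x y
     - 2 * dy k P x y * T i x y - dy i P x y * T k x y - R x y * dy k (dy i P) x y"
    using berwald_deriv_projective[OF deformed_spray_eq smooth_PRTQ(1), of tau i x y k]
      homogeneous_PRTQ assms tau_position[OF assms] by simp
  also have "\<dots> = - (c * (2 * c + 1) / 2) * dy k (dy i Q) x y"
    unfolding T_derivs[OF assms] P_derivs[OF assms] Q_derivs[OF assms]
    by (simp add: P_def T_def R_def power2_eq_square field_simps)
  finally show ?thesis .
qed

text \<open>
  The curvature determines $\tau$, so a constant curvature spray has $c (2 c + 1) Q_{y^i y^k} = 0$.
  If $c (2 c + 1) \ne 0$, Euler's relation applied twice gives $Q = 0$ everywhere, contrary to
  \<open>Q_not_zero\<close>.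
\<close>

lemma constant_curvature_iff:
  "constant_curvature (slit_tangent \<Omega>) G \<longleftrightarrow> c = 0 \<or> c = - 1/2"
proof
  assume "c = 0 \<or> c = - 1/2"
  then have "berwald_deriv G tau i k x y = 0" if "x \<in> \<Omega>" "y \<noteq> 0" for x y i k
    using berwald_deriv_tau[OF that] by auto
  then show "constant_curvature (slit_tangent \<Omega>) G"
    unfolding constant_curvature_def
    using scalar_curvature_G by (intro exI[of _ R] exI[of _ tau]) auto
next
  assume "constant_curvature (slit_tangent \<Omega>) G"
  then obtain R' \<tau> where sc: "scalar_curvature_with (slit_tangent \<Omega>) G R' \<tau>"
    and bd: "\<And>x y i k. (x, y) \<in> slit_tangent \<Omega> \<Longrightarrow> berwald_deriv G \<tau> i k x y = 0"
    unfolding constant_curvature_def by fast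
  have eq: "\<tau> x y $ k = T k x y" if "(x, y) \<in> slit_tangent \<Omega>" for x y k
  proof (rule isotropic_operator_unique[OF card])
    show "y \<noteq> 0" using that by simp
    show "R' x y * of_bool (i = k) - \<tau> x y $ k * y $ i = R x y * of_bool (i = k) - T k x y * y $ i" for i k
      using sc scalar_curvature_G that unfolding scalar_curvature_with_def by fastforce
  qed
  show "c = 0 \<or> c = - 1/2"
  proof (rule ccontr)
    assume nc: "\<not> (c = 0 \<or> c = - 1/2)"
    have "Q x y = 0" if "x \<in> \<Omega>" "y \<noteq> 0" for x y
    proof -
      have xy: "(x, y) \<in> slit_tangent \<Omega>" using that by simp
      have "berwald_deriv G \<tau> i k x y = berwald_deriv G tau i k x y" for i k
      proof -
        have "dx k (coord \<tau> i) x y = dx k (coord tau i) x y" "dy r (coord \<tau> i) x y = dy r (coord tau i) x y" for r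
          using eq by (auto intro!: dx_cong[OF xy] dy_cong[OF xy] simp: coord_def)
        then show ?thesis
          using eq[OF xy] by (simp add: berwald_deriv_def hor_deriv_def)
      qed
      then have "dy k (dy i Q) x y = 0" for i k
        using bd[OF xy, of i k] berwald_deriv_tau[OF that, of i k] nc by auto
      then have "dy i Q x y = 0" for i
        using euler_dy[OF smooth_PRTQ(4), of 2 x y i] homogeneous_PRTQ(4) xy by simp
      then show "Q x y = 0"
        using euler[OF smooth_PRTQ(4) homogeneous_PRTQ(4) xy] by simp
    qed
    moreover have "slit_tangent \<Omega> \<noteq> {}"
    proof -
      obtain x where "x \<in> \<Omega>" using domain(2) by blast
      then have "(x, axis undefined 1) \<in> slit_tangent \<Omega>" by (simp add: axis_eq_0_iff)
      then show ?thesis by blast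
    qed
    ultimately show False
      using Q_not_zero[OF open_region subset_refl] by fastforce
  qed
qed

end

section \<open>Metrics inducing the deformed spray force a vanishing Hessian\<close>

text \<open>
  The gradients of \<open>Q\<close> and $R$ are linear combinations of those of the Funk metric and its reverse,
  with determinant a multiple of $a b (a + b)$. The assumptions make the gradient of $R$ a multiple
  of that of \<open>Q\<close>, so Cramer's rule makes the gradient \<open>ak\<close> of the Funk metric one as well. The
  factor \<open>m\<close> does not depend on the index, so that it can be found by contraction.
\<close>

lemma gradient_parallel:
  fixes a b c q r l :: real and ak bk qk tk lk :: "'k \<Rightarrow> real"
  assumes qk: "\<And>k. qk k = b\<^sup>2 * ak k + 2 * (a * b + (c + 1) * b\<^sup>2) * bk k"
    and tk: "\<And>k. tk k = c/2 * (a * bk k + b * ak k) + (c\<^sup>2 + c) * (b * bk k) - 1/4 * (a * ak k)"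
    and ql: "\<And>k. 2 * qk k * l = 3 * q * lk k" and rl: "\<And>k. r * lk k = 2 * tk k * l"
    and nz: "l \<noteq> 0" "q \<noteq> 0"
  obtains m where "\<And>k. a * b * (a + b) * ak k = m * qk k"
proof
  fix k
  have "3 * q * (2 * tk k * l) = r * (3 * q * lk k)"
    using rl[of k] by (simp add: mult_ac)
  also have "\<dots> = r * (2 * qk k * l)" by (simp add: ql)
  finally have t: "tk k = r / (3 * q) * qk k"
    using nz by (simp add: field_simps)
  have "a * b * (a + b) * ak k = (c * a + 2 * (c\<^sup>2 + c) * b) * qk k - 4 * (a * b + (c + 1) * b\<^sup>2) * tk k"
    unfolding qk tk by (simp add: field_simps power2_eq_square)
  then show "a * b * (a + b) * ak k
      = (c * a + 2 * (c\<^sup>2 + c) * b - 4 * (a * b + (c + 1) * b\<^sup>2) * (r / (3 * q))) * qk k"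
    unfolding t by (simp add: algebra_simps)
qed

text \<open>
  Here $a$, $q$, $l$ stand for the values of \<open>F\<close>, \<open>Q\<close> and the metric, and suffixes for vertical
  derivatives. Up to factors constant on the fibre, the relations say that $a$ and $l$ are the
  powers $1/3$ and $2/3$ of $q$ and that the gradient of $q$ is $l$ times a fixed covector. To
  second order $q$ is then the cube of a linear function, and $a$ is a linear function.
\<close>

lemma second_derivative_vanishes:
  fixes a q l :: real
  assumes "3 * q * ak = a * qk" "3 * q * al = a * ql" "2 * ql * l = 3 * q * ll" "qkl * l = qk * ll"
    "3 * ql * ak + 3 * q * akl = al * qk + a * qkl" "q \<noteq> 0" "l \<noteq> 0"
  shows "akl = 0"
proof -
  have ak: "ak = a * qk / (3 * q)" and al: "al = a * ql / (3 * q)" and ll: "ll = 2 * ql * l / (3 * q)"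
    using assms(1-3,6) by (simp_all add: field_simps)
  have qkl: "qkl = 2 * qk * ql / (3 * q)"
    using assms(4,6,7) unfolding ll by (simp add: field_simps)
  have "3 * q * akl = al * qk + a * qkl - 3 * ql * ak" using assms(5) by simp
  also have "\<dots> = 0" unfolding ak al qkl using assms(6) by (simp add: field_simps)
  finally show ?thesis using assms(6) by simp
qed

context deformed_funk
begin

lemma invertible_fund_tensor_funk:
  "x \<in> \<Omega> \<Longrightarrow> y \<noteq> 0 \<Longrightarrow> invertible (fund_tensor (\<lambda>x y. (F x y)\<^sup>2) x y)"
  using finsler unfolding pos_finsler_metric_def finsler_metric_def by fastforce

text \<open>
  If the Hessian of \<open>F\<close> vanished, the fundamental tensor of \<open>F\<^sup>2\<close> would be $F_{y^i} F_{y^j}$, of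
  rank one, and would annihilate a vector orthogonal to the gradient.
\<close>

lemma funk_hessian_not_zero:
  assumes "x \<in> \<Omega>" "y \<noteq> 0"
  obtains k l where "dy l (dy k F) x y \<noteq> 0"
proof (rule ccontr)
  assume "\<not> thesis"
  then have z: "dy l (dy k F) x y = 0" for k l using that by blast
  have xy: "(x, y) \<in> slit_tangent \<Omega>" using assms by simp
  obtain v :: "real ^ 'n" where v: "v \<noteq> 0" "orthogonal (\<chi> k. dy k F x y) v"
    using orthogonal_to_vector_exists[of "\<chi> k. dy k F x y"] card by auto
  have "(\<Sum>j\<in>UNIV. dy j F x y * v $ j) = 0"
    using v(2) by (simp add: orthogonal_def inner_vec_def)
  then have "fund_tensor (\<lambda>x y. (F x y)\<^sup>2) x y *v v = 0"
    by (simp add: matrix_vector_mult_def fund_tensor_square[OF funk_smooth xy] z vec_eq_iff mult.assoc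
        sum_distrib_left[symmetric])
  then show False
    using invertible_fund_tensor_funk[OF assms] v(1) invertible_iff_kernel by blast
qed

text \<open>
  Let $\lambda = R / L$. By the integrability condition $\lambda$ is locally constant on fibres, so its
  derivative $\lambda_{x^k} = - c (2 c + 1) Q_{y^k} / L$ is so too. Hence
  $Q_{y^k y^l} L = Q_{y^k} L_{y^l}$, and the symmetry of the left-hand side makes the gradients of
  \<open>L\<close> and \<open>Q\<close> proportional. On the open set where \<open>Q\<close> is nonzero, which is not empty by
  \<open>Q_not_zero\<close>, \<open>gradient_parallel\<close> and \<open>second_derivative_vanishes\<close> apply.
\<close>

lemma not_metrizable:
  assumes nc: "c \<noteq> 0" "c \<noteq> - 1/2" and U: "U \<noteq> {}"
    and C': "C' \<subseteq> slit_tangent \<Omega>" and L: "finsler_metric U C' L" and ind: "induced_by C' G L"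
  shows False
proof -
  have cr: "conical_region U C'" and sL: "smooth_phase C' L" and hL: "pos_homogeneous 2 C' L"
    and nzL: "\<And>x y. (x, y) \<in> C' \<Longrightarrow> L x y \<noteq> 0"
    and invL: "\<And>x y. (x, y) \<in> C' \<Longrightarrow> invertible (fund_tensor L x y)"
    using L unfolding finsler_metric_def by auto
  interpret C': conical_phase_region C'
    using cr by unfold_locales (auto simp: conical_region_def)
  have in\<Omega>: "x \<in> \<Omega>" "y \<noteq> 0" if "(x, y) \<in> C'" for x y using that C' by auto
  have sm [simp]: "smooth_phase C' F" "smooth_phase C' Frev" "smooth_phase C' P" "smooth_phase C' R"
    "smooth_phase C' (T k)" "smooth_phase C' Q" for k
    using smooth_subset[OF _ C'] by simp_all
  have hom: "pos_homogeneous 1 C' P" "pos_homogeneous 3 C' Q"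
    using homogeneous_PRTQ C' unfolding pos_homogeneous_def by blast+
  have "\<forall>(x, y)\<in>C'. finsler_spray L x y = P x y *\<^sub>R y"
    using ind C' deformed_spray_eq unfolding induced_by_def by fastforce
  then have hc: "C'.horizontally_constant P L"
    using C'.finsler_spray_projective[OF sL hL sm(3) hom(1) invL] by blast
  have hamel: "C'.hamel P"
    using hamel_P C' unfolding hamel_def C'.hamel_def by blast
  have dxL: "dx k L x y = 2 * dy k P x y * L x y + P x y * dy k L x y" if "(x, y) \<in> C'" for x y k
    using hc that unfolding C'.horizontally_constant_def by fast
  have RL: "R x y * dy k L x y = 2 * T k x y * L x y" if "(x, y) \<in> C'" for x y k
    using C'.horizontally_constant_curvature[OF hc sL hL sm(3) hom(1) hamel that, of k]
      curvature_R[OF in\<Omega>[OF that]] by (simp add: C'.spray_deriv_def spray_deriv_def)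
  define K where "K = c * (2 * c + 1)"
  have K: "K \<noteq> 0" using nc by (auto simp: K_def)
  define il where "il = (\<lambda>x y. inverse (L x y))"
  have sil [simp]: "smooth_phase C' il"
    unfolding il_def by (rule C'.smooth_inverse[OF sL nzL])
  have dil: "dx k il x y = - dx k L x y / (L x y)\<^sup>2" "dy k il x y = - dy k L x y / (L x y)\<^sup>2"
    if "(x, y) \<in> C'" for x y k
    unfolding il_def using C'.dx_inverse[OF sL that nzL[OF that]] C'.dy_inverse[OF sL that nzL[OF that]] by auto
  define lam where "lam = (\<lambda>x y. R x y * il x y)"
  have slam [simp]: "smooth_phase C' lam" by (simp add: lam_def)
  have lam_y: "dy k lam x y = 0" if "(x, y) \<in> C'" for x y k
    using RL[OF that, of k] nzL[OF that] that R_derivs(1)[OF in\<Omega>[OF that]]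
    by (simp add: lam_def dil) (simp add: il_def field_simps power2_eq_square)
  have lam_x: "dx k lam x y = - K * dy k Q x y * il x y" if "(x, y) \<in> C'" for x y k
  proof -
    have "dx k lam x y = dx k R x y * inverse (L x y) - R x y * dx k L x y / (L x y)\<^sup>2"
      using that by (simp add: lam_def dil) (simp add: il_def)
    also have "\<dots> = - K * dy k Q x y * inverse (L x y) + P x y * (2 * T k x y * L x y - R x y * dy k L x y) / (L x y)\<^sup>2"
      unfolding R_derivs[OF in\<Omega>[OF that]] dxL[OF that] K_def
      using nzL[OF that] by (simp add: field_simps power2_eq_square)
    finally show ?thesis using RL[OF that, of k] by (simp add: il_def)
  qed
  have QL: "dy l (dy k Q) x y * L x y = dy k Q x y * dy l L x y" if "(x, y) \<in> C'" for x y k l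
  proof -
    \<comment> \<open>The mixed derivative vanishes because \<open>lam\<close> is locally constant on fibres.\<close>
    have "dy l (\<lambda>x y. - K * dy k Q x y * il x y) x y = dy l (dx k lam) x y"
      using lam_x by (intro C'.dy_cong[OF that]) simp
    also have "\<dots> = dx k (dy l lam) x y" using C'.dx_dy_commute[OF slam that] by simp
    also have "\<dots> = dx k (\<lambda>x y. 0) x y" by (intro C'.dx_cong[OF that] lam_y)
    finally have "dy l (\<lambda>x y. - K * dy k Q x y * il x y) x y = 0" by simp
    then have "K * (dy l (dy k Q) x y * L x y - dy k Q x y * dy l L x y) = 0"
      using that nzL[OF that] by (simp add: dil) (simp add: il_def field_simps power2_eq_square, metis)
    then show ?thesis using K by simp
  qed
  have QL2: "2 * dy k Q x y * L x y = 3 * Q x y * dy k L x y" if "(x, y) \<in> C'" for x y k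
  proof -
    have "dy k Q x y * dy l L x y = dy l Q x y * dy k L x y" for l
      using QL[OF that, of l k] QL[OF that, of k l] C'.dy_dy_commute[OF sm(6) that, of k l] by simp
    then have "(\<Sum>l\<in>UNIV. dy k Q x y * (y $ l * dy l L x y)) = (\<Sum>l\<in>UNIV. dy k L x y * (y $ l * dy l Q x y))"
      by (intro sum.cong) (auto simp: mult_ac)
    then have "dy k Q x y * (\<Sum>l\<in>UNIV. y $ l * dy l L x y) = dy k L x y * (\<Sum>l\<in>UNIV. y $ l * dy l Q x y)"
      by (simp only: sum_distrib_left)
    then show ?thesis
      using C'.euler[OF sL hL that] C'.euler[OF sm(6) hom(2) that] by (simp add: mult_ac)
  qed
  have FQ: "3 * Q x y * dy k F x y = F x y * dy k Q x y" if xyC: "(x, y) \<in> C'" and q: "Q x y \<noteq> 0" for x y k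
  proof -
    note xy = in\<Omega>[OF xyC]
    obtain m where m: "\<And>k. F x y * Frev x y * (F x y + Frev x y) * dy k F x y = m * dy k Q x y"
      using gradient_parallel[of "\<lambda>k. dy k Q x y" "Frev x y" "\<lambda>k. dy k F x y" "F x y" c "\<lambda>k. dy k Frev x y"
          "\<lambda>k. T k x y" "L x y" "Q x y" "\<lambda>k. dy k L x y" "R x y"]
        Q_derivs(1)[OF xy] T_def QL2[OF xyC] RL[OF xyC] nzL[OF xyC] q by metis
    have "F x y * Frev x y * (F x y + Frev x y) * (\<Sum>k\<in>UNIV. y $ k * dy k F x y) = m * (\<Sum>k\<in>UNIV. y $ k * dy k Q x y)"
      unfolding sum_distrib_left using m by (intro sum.cong) (auto simp: mult_ac)
    then have m': "F x y * Frev x y * (F x y + Frev x y) * F x y = m * (3 * Q x y)"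
      using euler_funk(1)[OF xy] C'.euler[OF sm(6) hom(2) xyC] by simp
    have "F x y * Frev x y * (F x y + Frev x y) * (3 * Q x y * dy k F x y)
       = 3 * Q x y * (F x y * Frev x y * (F x y + Frev x y) * dy k F x y)" by (simp only: mult_ac)
    also have "\<dots> = (m * (3 * Q x y)) * dy k Q x y" unfolding m by (simp only: mult_ac)
    also have "\<dots> = F x y * Frev x y * (F x y + Frev x y) * (F x y * dy k Q x y)"
      unfolding m'[symmetric] by (simp only: mult_ac)
    finally show ?thesis using funk_pos[OF xy] Frev_pos[OF xy] by simp
  qed
  \<comment> \<open>The relation \<open>FQ\<close> is differentiated, so it has to hold on an open set.\<close>
  define D where "D = {z \<in> C'. case_prod Q z \<in> - {0}}"
  have "continuous_on C' (case_prod Q)"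
    using sm(6) unfolding smooth_phase_def by (rule smooth_on_continuous)
  then have "open D"
    unfolding D_def
    using continuous_open_preimage[OF _ C'.open_region open_Compl[OF closed_singleton], of "case_prod Q" 0]
    by (simp add: vimage_def Int_def)
  interpret D: phase_region D by unfold_locales (rule \<open>open D\<close>)
  have DC: "D \<subseteq> C'" by (auto simp: D_def)
  have smD [simp]: "smooth_phase D F" "smooth_phase D Q"
    using C'.smooth_subset[OF _ DC] by simp_all
  obtain x where "x \<in> U" using U by blast
  then have "C' \<noteq> {}" using cr unfolding conical_region_def by blast
  then obtain x y where "(x, y) \<in> C'" "Q x y \<noteq> 0"
    using Q_not_zero[OF C'.open_region C'] by blast
  then have xyD: "(x, y) \<in> D" by (simp add: D_def)
  then have xyC: "(x, y) \<in> C'" and q: "Q x y \<noteq> 0" by (auto simp: D_def)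
  have "dy l (dy k F) x y = 0" for k l
  proof (rule second_derivative_vanishes[where l = "L x y" and ll = "dy l L x y"])
    have "dy l (\<lambda>x y. 3 * Q x y * dy k F x y) x y = dy l (\<lambda>x y. F x y * dy k Q x y) x y"
      using FQ by (intro D.dy_cong[OF xyD]) (auto simp: D_def)
    then show "3 * dy l Q x y * dy k F x y + 3 * Q x y * dy l (dy k F) x y
        = dy l F x y * dy k Q x y + F x y * dy l (dy k Q) x y"
      using xyD by simp
  qed (use FQ[OF xyC q] QL[OF xyC] QL2[OF xyC] q nzL[OF xyC] in simp_all)
  then show False using funk_hessian_not_zero[OF in\<Omega>[OF xyC]] by metis
qed

section \<open>The Klein metric\<close>

text \<open>
  The Hessian of a function of degree one annihilates \<open>y\<close>. Subtracting from \<open>v\<close> the multiple of \<open>y\<close>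
  with the same derivative of \<open>F\<close> leaves a vector in the kernel of the fundamental tensor of
  \<open>F\<^sup>2\<close>, which is zero. Semidefiniteness is needed to pass from a zero of the quadratic form to the
  kernel of the Hessian.
\<close>

lemma funk_hessian_kernel:
  assumes "x \<in> \<Omega>" "y \<noteq> 0"
    and v: "(\<Sum>i\<in>UNIV. \<Sum>j\<in>UNIV. v $ i * v $ j * dy j (dy i F) x y) = 0"
  obtains s where "v = s *\<^sub>R y"
proof -
  have xy: "(x, y) \<in> slit_tangent \<Omega>" using assms by simp
  define H :: "real ^ 'n ^ 'n" where "H = (\<chi> i j. dy j (dy i F) x y)"
  have form: "w \<bullet> (H *v w) = (\<Sum>i\<in>UNIV. \<Sum>j\<in>UNIV. w $ i * w $ j * dy j (dy i F) x y)" for w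
    by (simp add: H_def inner_vec_def matrix_vector_mult_def sum_distrib_left mult_ac)
  have "transpose H = H"
    using dy_dy_commute[OF funk_smooth xy] by (simp add: H_def transpose_def vec_eq_iff)
  then have Hv: "H *v v = 0"
    using psd_form_zero_imp_kernel[of H v] funk_hessian_psd(1)[OF assms(1,2)] v by (simp add: form)
  have Hy: "H *v y = 0"
    using euler_funk(3)[OF assms(1,2)] by (simp add: H_def matrix_vector_mult_def vec_eq_iff mult.commute)
  define s where "s = (\<Sum>j\<in>UNIV. v $ j * dy j F x y) / F x y"
  define u where "u = v - s *\<^sub>R y"
  have Hu: "H *v u = 0"
    using Hv Hy by (simp add: u_def matrix_vector_mult_diff_distrib linear_cmul[OF matrix_vector_mul_linear])
  have "(\<Sum>j\<in>UNIV. u $ j * dy j F x y)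
      = (\<Sum>j\<in>UNIV. v $ j * dy j F x y) - s * (\<Sum>j\<in>UNIV. y $ j * dy j F x y)"
    by (simp add: u_def left_diff_distrib sum_subtractf sum_distrib_left mult.assoc)
  then have Fu: "(\<Sum>j\<in>UNIV. u $ j * dy j F x y) = 0"
    using euler_funk(1)[OF assms(1,2)] funk_pos[OF assms(1,2)] by (simp add: s_def)
  have "(fund_tensor (\<lambda>x y. (F x y)\<^sup>2) x y *v u) $ i
      = dy i F x y * (\<Sum>j\<in>UNIV. u $ j * dy j F x y) + F x y * (H *v u) $ i" for i
    by (simp add: matrix_vector_mult_def fund_tensor_square[OF funk_smooth xy] H_def sum_distrib_left
        flip: sum.distrib) (simp add: algebra_simps)
  then have "fund_tensor (\<lambda>x y. (F x y)\<^sup>2) x y *v u = 0"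
    by (simp add: vec_eq_iff Fu Hu)
  then have "u = 0"
    using invertible_fund_tensor_funk[OF assms(1,2)] invertible_iff_kernel by blast
  then have "v = s *\<^sub>R y" by (simp add: u_def)
  then show thesis by (rule that)
qed

lemma klein_metric_eq: "klein_metric F = (\<lambda>x y. 1/2 * (F x y + Frev x y))"
  by (intro ext) (simp add: klein_metric_def Frev_def)

lemma klein_smooth [simp]: "smooth (klein_metric F)"
  by (simp add: klein_metric_eq)

lemma klein_homogeneous: "homogeneous 1 (klein_metric F)"
  using funk_homogeneous Frev_homogeneous
  by (auto simp: klein_metric_eq pos_homogeneous_def slit_tangent_def algebra_simps)

lemma klein_derivs:
  assumes "x \<in> \<Omega>" "y \<noteq> 0"
  shows "dy k (klein_metric F) x y = 1/2 * (dy k F x y + dy k Frev x y)"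
    and "dx k (klein_metric F) x y = 1/2 * (F x y * dy k F x y - Frev x y * dy k Frev x y)"
    and "dy j (dy k (klein_metric F)) x y = 1/2 * (dy j (dy k F) x y + dy j (dy k Frev) x y)"
proof -
  have xy: "(x, y) \<in> slit_tangent \<Omega>" using assms by simp
  have k: "dy k (klein_metric F) x y = 1/2 * (dy k F x y + dy k Frev x y)"
    if "(x, y) \<in> slit_tangent \<Omega>" for x y
    using that by (simp add: klein_metric_eq)
  show "dy k (klein_metric F) x y = 1/2 * (dy k F x y + dy k Frev x y)" using k[OF xy] .
  show "dx k (klein_metric F) x y = 1/2 * (F x y * dy k F x y - Frev x y * dy k Frev x y)"
    using assms by (simp add: klein_metric_eq dx_funk dx_Frev)
  show "dy j (dy k (klein_metric F)) x y = 1/2 * (dy j (dy k F) x y + dy j (dy k Frev) x y)"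
    using dy_cong[OF xy k] assms by simp
qed

lemma klein_pos: "x \<in> \<Omega> \<Longrightarrow> y \<noteq> 0 \<Longrightarrow> klein_metric F x y > 0"
  using funk_pos Frev_pos by (simp add: klein_metric_eq add_pos_pos)

text \<open>
  The fundamental tensor of a square \<open>k\<^sup>2\<close> is $k_{y^i} k_{y^j} + k k_{y^i y^j}$. Both parts are
  positive semidefinite here; a vector annihilated by the second is a multiple of \<open>y\<close>, on which
  the first is positive.
\<close>

lemma invertible_fund_tensor_klein:
  assumes "x \<in> \<Omega>" "y \<noteq> 0"
  shows "invertible (fund_tensor (\<lambda>x y. (klein_metric F x y)\<^sup>2) x y)"
  unfolding invertible_iff_kernel
proof clarify
  fix v assume v: "fund_tensor (\<lambda>x y. (klein_metric F x y)\<^sup>2) x y *v v = 0"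
  have xy: "(x, y) \<in> slit_tangent \<Omega>" using assms by simp
  let ?k = "klein_metric F"
  let ?l = "\<Sum>i\<in>UNIV. v $ i * dy i ?k x y"
  let ?h = "\<lambda>f. \<Sum>i\<in>UNIV. \<Sum>j\<in>UNIV. v $ i * v $ j * dy j (dy i f) x y"
  have "0 = v \<bullet> (fund_tensor (\<lambda>x y. (?k x y)\<^sup>2) x y *v v)" using v by simp
  also have "\<dots> = (\<Sum>i\<in>UNIV. \<Sum>j\<in>UNIV. (v $ i * dy i ?k x y) * (v $ j * dy j ?k x y)
      + ?k x y * (v $ i * v $ j * dy j (dy i ?k) x y))"
    by (simp add: inner_vec_def matrix_vector_mult_def fund_tensor_square[OF klein_smooth xy]
        sum_distrib_left) (simp add: algebra_simps)
  also have "\<dots> = ?l * ?l + ?k x y * ?h ?k"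
    by (simp add: sum.distrib sum_distrib_left sum_distrib_right mult.commute)
  also have "?h ?k = 1/2 * (?h F + ?h Frev)"
    by (simp add: klein_derivs(3)[OF assms] sum_distrib_left flip: sum.distrib) (simp add: field_simps)
  finally have sum0: "?l * ?l + ?k x y * (1/2 * (?h F + ?h Frev)) = 0" by simp
  have psd: "?h F \<ge> 0" "?h Frev \<ge> 0" using funk_hessian_psd[OF assms] by auto
  have "?k x y * (1/2 * (?h F + ?h Frev)) \<ge> 0"
    using psd klein_pos[OF assms] by (intro mult_nonneg_nonneg) auto
  then have "?l * ?l = 0" "?k x y * (1/2 * (?h F + ?h Frev)) = 0"
    using sum0 zero_le_square[of ?l] by linarith+
  then have l0: "?l = 0" and "?h F + ?h Frev = 0"
    using klein_pos[OF assms] by auto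
  then have "?h F = 0" using psd by linarith
  then obtain s where s: "v = s *\<^sub>R y" using funk_hessian_kernel[OF assms] by blast
  have "?l = s * ?k x y"
    using euler[OF klein_smooth klein_homogeneous xy] by (simp add: s mult.assoc sum_distrib_left[symmetric])
  then have "s = 0" using l0 klein_pos[OF assms] by simp
  then show "v = 0" by (simp add: s)
qed

lemma klein_finsler: "pos_finsler_metric \<Omega> (slit_tangent \<Omega>) (klein_metric F)"
proof -
  have "conical_region \<Omega> (slit_tangent \<Omega>)"
    using finsler by (simp add: pos_finsler_metric_def finsler_metric_def)
  moreover have "homogeneous 2 (\<lambda>x y. (klein_metric F x y)\<^sup>2)"
    using klein_homogeneous by (auto simp: pos_homogeneous_def power_mult_distrib)
  ultimately show ?thesis
    using klein_pos invertible_fund_tensor_klein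
    by (auto simp: pos_finsler_metric_def finsler_metric_def less_imp_neq[symmetric])
qed

text \<open>
  For \<open>c = - 1/2\<close> the factor is half the difference of \<open>F\<close> and \<open>Frev\<close> and the Klein metric half
  their sum, so their product is a quarter of the difference of squares, whose vertical derivative
  is $\partial_k$ of the Klein metric by Okada's identity. Multiplying by twice the Klein metric gives
  the equation for its square.
\<close>

lemma klein_induces:
  assumes c: "c = - 1/2"
  shows "induced_by (slit_tangent \<Omega>) G (\<lambda>x y. (klein_metric F x y)\<^sup>2)"
proof -
  have "dx k (\<lambda>x y. (klein_metric F x y)\<^sup>2) x y
      = 2 * dy k P x y * (klein_metric F x y)\<^sup>2 + P x y * dy k (\<lambda>x y. (klein_metric F x y)\<^sup>2) x y"
    if "x \<in> \<Omega>" "y \<noteq> 0" for x y k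
    using that by (simp add: klein_derivs P_derivs)
      (simp add: klein_metric_eq P_def, simp add: c power2_eq_square field_simps)
  then have "horizontally_constant P (\<lambda>x y. (klein_metric F x y)\<^sup>2)"
    by (auto simp: horizontally_constant_def)
  moreover have "finsler_metric \<Omega> (slit_tangent \<Omega>) (\<lambda>x y. (klein_metric F x y)\<^sup>2)"
    using klein_finsler by (simp add: pos_finsler_metric_def)
  ultimately have "\<forall>(x, y)\<in>slit_tangent \<Omega>. finsler_spray (\<lambda>x y. (klein_metric F x y)\<^sup>2) x y = P x y *\<^sub>R y"
    unfolding finsler_metric_def
    using finsler_spray_projective[OF _ _ smooth_PRTQ(1) homogeneous_PRTQ(1)] by fast
  then show ?thesis
    unfolding induced_by_def using deformed_spray_eq by fastforce
qed

lemma funk_induces: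
  "c = 0 \<Longrightarrow> induced_by (slit_tangent \<Omega>) G (\<lambda>x y. (F x y)\<^sup>2)"
  by (simp add: induced_by_def deformed_spray_def)

lemma metrizable_if:
  assumes "c = 0 \<or> c = - 1/2"
  shows "metrizable_over \<Omega> (slit_tangent \<Omega>) G"
  using assms
proof
  assume "c = 0"
  then show ?thesis
    using funk_induces finsler unfolding metrizable_over_def pos_finsler_metric_def by blast
next
  assume "c = - 1/2"
  then show ?thesis
    using klein_induces klein_finsler unfolding metrizable_over_def pos_finsler_metric_def by blast
qed

lemma locally_metrizable_if_metrizable:
  "metrizable_over \<Omega> (slit_tangent \<Omega>) G \<Longrightarrow> locally_metrizable_over \<Omega> (slit_tangent \<Omega>) G"
  using domain(1) unfolding locally_metrizable_over_def by blast

lemma locally_metrizable_only_if: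
  assumes "locally_metrizable_over \<Omega> (slit_tangent \<Omega>) G"
  shows "c = 0 \<or> c = - 1/2"
proof (rule ccontr)
  assume nc: "\<not> (c = 0 \<or> c = - 1/2)"
  obtain p where "p \<in> \<Omega>" using domain(2) by blast
  then obtain U where U: "p \<in> U" "metrizable_over U (slit_tangent \<Omega>) G"
    using assms unfolding locally_metrizable_over_def by blast
  then obtain C' L where "C' \<subseteq> slit_tangent \<Omega>" "finsler_metric U C' L" "induced_by C' G L"
    unfolding metrizable_over_def by blast
  then show False using not_metrizable[of U C' L] nc U(1) by blast
qed

end

section \<open>Curvature and metrizability of the deformed Funk spray\<close>

theorem theorem1p1:
  fixes \<Omega> :: "(real ^ 'n::finite) set"
    and F :: "real ^ 'n \<Rightarrow> real ^ 'n \<Rightarrow> real"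
    and c :: real
  assumes dim: "CARD('n) \<ge> 2"
    and domain: "open \<Omega>" "\<Omega> \<noteq> {}" "convex \<Omega>"
    and funk: "funk_metric \<Omega> F"
    and finsler: "pos_finsler_metric \<Omega> (slit_tangent \<Omega>) F"
  shows "spray \<Omega> (slit_tangent \<Omega>) (deformed_spray F c)
    \<and> isotropic_curvature (slit_tangent \<Omega>) (deformed_spray F c)
    \<and> (constant_curvature (slit_tangent \<Omega>) (deformed_spray F c) \<longleftrightarrow> c = 0 \<or> c = - 1/2)
    \<and> (metrizable_over \<Omega> (slit_tangent \<Omega>) (deformed_spray F c) \<longleftrightarrow> c = 0 \<or> c = - 1/2)
    \<and> (locally_metrizable_over \<Omega> (slit_tangent \<Omega>) (deformed_spray F c) \<longleftrightarrow> c = 0 \<or> c = - 1/2)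
    \<and> (c = 0 \<longrightarrow>
          induced_by (slit_tangent \<Omega>) (deformed_spray F c) (\<lambda>x y. (F x y)\<^sup>2))
    \<and> (c = - 1/2 \<longrightarrow>
          pos_finsler_metric \<Omega> (slit_tangent \<Omega>) (klein_metric F) \<and>
          induced_by (slit_tangent \<Omega>) (deformed_spray F c) (\<lambda>x y. (klein_metric F x y)\<^sup>2))"
proof -
  interpret deformed_funk \<Omega> F c
    by unfold_locales (rule dim domain funk finsler)+
  show ?thesis
    using spray_G isotropic_curvature_G constant_curvature_iff metrizable_if
      locally_metrizable_if_metrizable locally_metrizable_only_if funk_induces klein_finsler klein_induces
    by blast
qed

end
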